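(* Let $\lambda>0$, $\sigma>0$, $\mu\in\mathbb{R}$, $\theta>1$, let $\theta'$ be defined by $\frac1\theta+\frac1{\theta'}=1$, and let $x_0\in\mathbb{R}$. Consider the stochastic differential equation with jumps $$dX(t)=\mu\,dt+\sigma\,dW(t)-\frac{X(t-)}{\theta'}\,N(dt),\qquad X(0)=x_0,$$ where $W$ is a standard Brownian motion and $N$ is a point process with stochastic intensity $\Lambda(X(t-))$, $\Lambda(x)=\frac{\lambda}{|x|^{\alpha}}$. If $0\le\alpha<1$, then almost surely there is no finite accumulation time point of interactions (points of $N$), and the stochastic process $\{X(t)\}$ is well-defined over the whole time horizon $[0,\infty)$.
   Context: The points of $N$ are called interaction times; at each such time $t$ the process jumps from $X(t-)$ to $X(t-)/\theta$, and between interaction times it evolves as the diffusion $\mu\,dt+\sigma\,dW(t)$. The stochastic intensity is with respect to the natural filtration of the process. The process is constructed pathwise by induction on the successive interaction times $\gamma_1<\gamma_2<\cdots$: given the state $X(\gamma_n)$ (with $\gamma_0=0$), on $[\gamma_n,\gamma_{n+1})$ one sets $X(\gamma_n+t)=X(\gamma_n)+\mu t+\sigma(W(\gamma_n+t)-W(\gamma_n))$; conditionally on the past up to $\gamma_n$ and on $W$, the next interaction time satisfies $\mathbf{P}[\gamma_{n+1}-\gamma_n>t]=\exp\{-\int_0^t\Lambda(X(\gamma_n)+\mu s+\sigma(W(\gamma_n+s)-W(\gamma_n)))\,ds\}$; and $X(\gamma_{n+1})=X(\gamma_{n+1}-)/\theta$. "No finite accumulation point" means $\gamma_n\to\infty$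 almost surely as $n\to\infty$, so that $X(t)$ is defined for all $t\ge0$. *)

theory Defs
  imports "HOL-Probability.Probability"
begin

text \<open>Time is indexed by \<^typ>\<open>real\<close>; only the values \<open>W t\<close> with \<open>0 \<le> t\<close> are constrained
  and used. Paths are continuous surely, not just almost surely.\<close>

definition standard_brownian_motion :: "'a measure \<Rightarrow> (real \<Rightarrow> 'a \<Rightarrow> real) \<Rightarrow> bool" where
  "standard_brownian_motion M W \<longleftrightarrow>
     prob_space M \<and>
     (\<forall>t\<ge>0. W t \<in> borel_measurable M) \<and>
     (\<forall>\<omega>\<in>space M. W 0 \<omega> = 0) \<and>
     (\<forall>\<omega>\<in>space M. continuous_on {0..} (\<lambda>t. W t \<omega>)) \<and>
     (\<forall>s t. 0 \<le> s \<and> s < t \<longrightarrow>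
        distributed M lborel (\<lambda>\<omega>. W t \<omega> - W s \<omega>) (normal_density 0 (sqrt (t - s)))) \<and>
     (\<forall>\<tau> n. 0 \<le> \<tau> 0 \<and> (\<forall>i<n. \<tau> i < \<tau> (Suc i)) \<longrightarrow>
        prob_space.indep_vars M (\<lambda>_. borel) (\<lambda>i \<omega>. W (\<tau> (Suc i)) \<omega> - W (\<tau> i) \<omega>) {..<n::nat})"

text \<open>The rate \<open>lam / \<bar>x\<bar>\<^sup>\<alpha>\<close>, equal to \<open>\<infinity>\<close> at \<open>x = 0\<close> when \<open>\<alpha> > 0\<close>. The case \<open>\<alpha> = 0\<close> is
  separated only because \<open>0 powr 0 = 0\<close> in HOL, whereas here \<open>0\<^sup>0 = 1\<close>.\<close>

definition intensity :: "real \<Rightarrow> real \<Rightarrow> real \<Rightarrow> ennreal" where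
  "intensity lam \<alpha> x = ennreal lam / (if \<alpha> = 0 then 1 else ennreal (\<bar>x\<bar> powr \<alpha>))"

definition exp_neg :: "ennreal \<Rightarrow> real" where
  "exp_neg h = (if h = \<infinity> then 0 else exp (- enn2real h))"

text \<open>Position, \<open>s\<close> time units after time \<open>a\<close>, of the diffusion without jumps that is driven by
  the path \<open>w\<close> and is at \<open>z\<close> at time \<open>a\<close>.\<close>

definition free_flow :: "real \<Rightarrow> real \<Rightarrow> (real \<Rightarrow> real) \<Rightarrow> real \<Rightarrow> real \<Rightarrow> real \<Rightarrow> real" where
  "free_flow \<mu> \<sigma> w a z s = z + \<mu> * s + \<sigma> * (w (a + s) - w a)"

text \<open>In the following, \<open>g n\<close> is the \<open>n\<close>-th interaction time, with \<open>g 0 = 0\<close> the time origin (not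
  an interaction) and \<open>g n = \<infinity>\<close> if there are fewer than \<open>n\<close> interactions. The state \<open>X(g n)\<close>
  is meaningful only if \<open>g n < \<infinity>\<close>. Since \<open>w\<close> is continuous, the left limit \<open>X(g (Suc n)-)\<close>
  is the free flow started at \<open>X(g n)\<close>, evaluated at \<open>g (Suc n)\<close>.\<close>

primrec state_at :: "real \<Rightarrow> real \<Rightarrow> real \<Rightarrow> real \<Rightarrow> (real \<Rightarrow> real) \<Rightarrow> (nat \<Rightarrow> ereal) \<Rightarrow> nat \<Rightarrow> real" where
  "state_at \<mu> \<sigma> \<theta> x0 w g 0 = x0"
| "state_at \<mu> \<sigma> \<theta> x0 w g (Suc n) =
     free_flow \<mu> \<sigma> w (real_of_ereal (g n)) (state_at \<mu> \<sigma> \<theta> x0 w g n)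
       (real_of_ereal (g (Suc n)) - real_of_ereal (g n)) / \<theta>"

text \<open>The state \<open>X(t)\<close>; it is \<^term>\<open>None\<close> exactly when \<open>t\<close> lies in no interval
  \<open>[g n, g (Suc n))\<close>, in particular when \<open>t\<close> is at or beyond a finite accumulation point of the
  interaction times.\<close>

definition jump_process ::
  "real \<Rightarrow> real \<Rightarrow> real \<Rightarrow> real \<Rightarrow> (real \<Rightarrow> real) \<Rightarrow> (nat \<Rightarrow> ereal) \<Rightarrow> real \<Rightarrow> real option" where
  "jump_process \<mu> \<sigma> \<theta> x0 w g t =
     (if \<exists>n. g n \<le> ereal t \<and> ereal t < g (Suc n)
      then let n = (THE n. g n \<le> ereal t \<and> ereal t < g (Suc n)) in
        Some (free_flow \<mu> \<sigma> w (real_of_ereal (g n)) (state_at \<mu> \<sigma> \<theta> x0 w g n)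
                (t - real_of_ereal (g n)))
      else None)"

definition cumulative_intensity ::
  "real \<Rightarrow> real \<Rightarrow> real \<Rightarrow> real \<Rightarrow> real \<Rightarrow> real \<Rightarrow> (real \<Rightarrow> real) \<Rightarrow> (nat \<Rightarrow> ereal) \<Rightarrow> nat \<Rightarrow> real \<Rightarrow> ennreal"
  where
  "cumulative_intensity lam \<alpha> \<mu> \<sigma> \<theta> x0 w g n t =
     (\<integral>\<^sup>+ s\<in>{0..t}.
        intensity lam \<alpha>
          (free_flow \<mu> \<sigma> w (real_of_ereal (g n)) (state_at \<mu> \<sigma> \<theta> x0 w g n) s) \<partial>lborel)"

text \<open>The sigma-algebra of the past up to the \<open>n\<close>-th interaction time together with the whole
  of \<open>W\<close>. The states \<open>X(s)\<close> for \<open>s\<close> up to that time are functions of the listed variables.\<close>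

definition past_and_noise ::
  "'a measure \<Rightarrow> (real \<Rightarrow> 'a \<Rightarrow> real) \<Rightarrow> (nat \<Rightarrow> 'a \<Rightarrow> ereal) \<Rightarrow> nat \<Rightarrow> 'a measure" where
  "past_and_noise M W \<gamma> n = sigma (space M)
     ({\<gamma> k -` A \<inter> space M | k A. k \<le> n \<and> A \<in> sets borel} \<union>
      {W s -` A \<inter> space M | s A. 0 \<le> s \<and> A \<in> sets borel})"

text \<open>The conditional law of \<open>\<gamma> (Suc n) - \<gamma> n\<close> is prescribed at times \<open>t > 0\<close> only, and the times
  are only required to be weakly increasing: at \<open>t = 0\<close> the formula would say that \<open>\<gamma>\<close> is strictly
  increasing, which presupposes that the intensity is integrable near \<open>0\<close> along the path.\<close>

definition interaction_times ::
  "'a measure \<Rightarrow> (real \<Rightarrow> 'a \<Rightarrow> real) \<Rightarrow> real \<Rightarrow> real \<Rightarrow> real \<Rightarrow> real \<Rightarrow> real \<Rightarrow> real \<Rightarrow>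
     (nat \<Rightarrow> 'a \<Rightarrow> ereal) \<Rightarrow> bool" where
  "interaction_times M W lam \<alpha> \<mu> \<sigma> \<theta> x0 \<gamma> \<longleftrightarrow>
     (\<forall>n. \<gamma> n \<in> borel_measurable M) \<and>
     (\<forall>\<omega>\<in>space M. \<gamma> 0 \<omega> = 0 \<and> (\<forall>n. \<gamma> n \<omega> \<le> \<gamma> (Suc n) \<omega>)) \<and>
     (\<forall>n. \<forall>t>0. AE \<omega> in M. \<gamma> n \<omega> < \<infinity> \<longrightarrow>
        real_cond_exp M (past_and_noise M W \<gamma> n)
          (indicator {\<omega> \<in> space M. \<gamma> n \<omega> + ereal t < \<gamma> (Suc n) \<omega>}) \<omega>
        = exp_neg (cumulative_intensity lam \<alpha> \<mu> \<sigma> \<theta> x0 (\<lambda>s. W s \<omega>) (\<lambda>k. \<gamma> k \<omega>) n t))"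

text \<open>Integrated form, along one path, of \<open>dX(t) = \<mu> dt + \<sigma> dW(t) - X(t-)/\<theta>' N(dt)\<close> with
  \<open>X(0) = x0\<close>, where \<open>N\<close> has the points \<open>g 1, g 2, \<dots>\<close> and \<open>w 0 = 0\<close>. The witness
  \<open>l n\<close> is the left limit \<open>x(g (Suc n)-)\<close>. Without the finiteness clause the sum could be \<open>0\<close>
  by default.\<close>

definition solves_jump_sde ::
  "real \<Rightarrow> real \<Rightarrow> real \<Rightarrow> real \<Rightarrow> (real \<Rightarrow> real) \<Rightarrow> (nat \<Rightarrow> ereal) \<Rightarrow> (real \<Rightarrow> real) \<Rightarrow> bool" where
  "solves_jump_sde \<mu> \<sigma> \<theta>' x0 w g x \<longleftrightarrow>
     (\<exists>l. (\<forall>n. g (Suc n) < \<infinity> \<longrightarrow> (x \<longlongrightarrow> l n) (at_left (real_of_ereal (g (Suc n))))) \<and>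
          (\<forall>t\<ge>0. finite {n. g (Suc n) \<le> ereal t} \<and>
             x t = x0 + \<mu> * t + \<sigma> * w t - (\<Sum>n | g (Suc n) \<le> ereal t. l n / \<theta>')))"

end

theory Submission imports Defs begin

text \<open>The conditional law of the gaps is prescribed given all of \<open>W\<close>, so one may argue path by path.
  Suppose that \<open>\<integral> \<bar>c + Y s\<bar> powr - \<alpha> ds\<close>, taken over \<open>[0, 2T]\<close> with \<open>Y t = \<mu> t + \<sigma> W t\<close>, is
  bounded uniformly in \<open>c\<close>; between jumps the process is such a translate of \<open>Y\<close>. Then each gap
  started before \<open>T\<close> exceeds \<open>T\<close> with conditional probability at least some \<open>p > 0\<close> depending
  on \<open>W\<close> only, so given \<open>W\<close> the chance that \<open>n\<close> interactions fall into \<open>[0, T]\<close> is at most \<open>(1 - p) ^ n\<close>.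

  The uniform bound follows once almost surely the occupation time \<open>\<nu>\<close> of \<open>Y\<close> on every interval of
  radius \<open>1 / 2 ^ k\<close> is at most a constant times \<open>1 / b ^ k\<close>, for some \<open>b\<close> with
  \<open>2 powr \<alpha> < b < 2\<close>. Up to a constant, \<open>\<nu> ^ Suc m\<close> is bounded by the volume of the chains
  \<open>t\<^sub>0 < \<dots> < t\<^sub>m\<close> along which \<open>Y\<close> moves by at most \<open>2 / 2 ^ k\<close> at each step, a quantity that no
  longer depends on the interval. By independence of increments its expectation is
  \<open>O(1 / 2 ^ (k * m))\<close>, which is summable against \<open>b ^ (k * Suc m)\<close> for large \<open>m\<close>.\<close>

section \<open>Chains of small increments\<close>

text \<open>Unfolded, this is the volume of the times t < s_1 < ... < s_m < T for which every
  increment of \<open>y\<close> along t, s_1, ..., s_m has size at most \<open>r\<close>. The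
  iterated form exposes the first link, which both the lower bound by occupation times and the upper
  bound on expectations peel off.\<close>

primrec chain :: "(real \<Rightarrow> real) \<Rightarrow> real \<Rightarrow> real \<Rightarrow> nat \<Rightarrow> real \<Rightarrow> ennreal" where
  "chain y r T 0 t = 1"
| "chain y r T (Suc m) t =
     (\<integral>\<^sup>+ s\<in>{t<..<T}. (indicator {x. \<bar>x\<bar> \<le> r} (y s - y t) * chain y r T m s) \<partial>lborel)"

text \<open>Fubini will need joint measurability in outcome and time. Sampled on a grid of mesh 1 /
  (n + 1), the process is a countable patchwork of random variables, and continuity makes the
  samples converge at every point.\<close>

lemma continuous_paths_jointly_measurable:
  fixes Y :: "real \<Rightarrow> 'a \<Rightarrow> real"
  assumes Y: "\<And>t. Y t \<in> borel_measurable N"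
    and cont: "\<And>\<omega>. \<omega> \<in> space N \<Longrightarrow> continuous_on UNIV (\<lambda>t. Y t \<omega>)"
  shows "(\<lambda>p. Y (snd p) (fst p)) \<in> borel_measurable (N \<Otimes>\<^sub>M borel)"
proof (rule borel_measurable_LIMSEQ_real)
  let ?Y = "\<lambda>(n::nat) p. Y (real_of_int \<lfloor>real (Suc n) * snd p\<rfloor> / real (Suc n)) (fst p)"
  show "?Y n \<in> borel_measurable (N \<Otimes>\<^sub>M borel)" for n
    by (rule measurable_compose_countable[where f="\<lambda>i p. Y (real_of_int i / real (Suc n)) (fst p)"
          and g="\<lambda>p. \<lfloor>real (Suc n) * snd p\<rfloor>"])
       (use Y in measurable)
  show "(\<lambda>n. ?Y n p) \<longlonglongrightarrow> Y (snd p) (fst p)" if "p \<in> space (N \<Otimes>\<^sub>M borel)" for p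
  proof -
    have *: "(\<lambda>n. real_of_int \<lfloor>real (Suc n) * snd p\<rfloor> / real (Suc n)) \<longlonglongrightarrow> snd p"
    proof (rule real_tendsto_sandwich)
      have "(real (Suc n) * snd p - 1) / real (Suc n) \<le> real_of_int \<lfloor>real (Suc n) * snd p\<rfloor> / real (Suc n)" for n
        by (rule divide_right_mono) linarith+
      moreover have "(real (Suc n) * snd p - 1) / real (Suc n) = snd p - 1 / real (Suc n)" for n
        by (simp add: diff_divide_distrib del: of_nat_Suc)
      ultimately show "\<forall>\<^sub>F n in sequentially. snd p - 1 / real (Suc n) \<le> real_of_int \<lfloor>real (Suc n) * snd p\<rfloor> / real (Suc n)"
        by simp
      have "real_of_int \<lfloor>real (Suc n) * snd p\<rfloor> / real (Suc n) \<le> (real (Suc n) * snd p) / real (Suc n)" for n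
        by (rule divide_right_mono) linarith+
      then show "\<forall>\<^sub>F n in sequentially. real_of_int \<lfloor>real (Suc n) * snd p\<rfloor> / real (Suc n) \<le> snd p"
        by (simp del: of_nat_Suc)
      show "(\<lambda>n. snd p - 1 / real (Suc n)) \<longlonglongrightarrow> snd p"
        using tendsto_diff[OF tendsto_const LIMSEQ_inverse_real_of_nat, of "snd p"]
        by (simp add: inverse_eq_divide)
    qed simp
    have "fst p \<in> space N" using that by (auto simp: space_pair_measure)
    from cont[OF this] have "isCont (\<lambda>t. Y t (fst p)) (snd p)"
      by (simp add: continuous_on_eq_continuous_at)
    from isCont_tendsto_compose[OF this *] show ?thesis .
  qed
qed

lemma chain_jointly_measurable:
  fixes Y :: "real \<Rightarrow> 'a \<Rightarrow> real"
  assumes [measurable]: "(\<lambda>p. Y (snd p) (fst p)) \<in> borel_measurable (N \<Otimes>\<^sub>M borel)"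
  shows "(\<lambda>p. chain (\<lambda>s. Y s (fst p)) r T m (snd p)) \<in> borel_measurable (N \<Otimes>\<^sub>M borel)"
proof (induction m)
  case (Suc m)
  let ?f = "\<lambda>p. chain (\<lambda>s. Y s (fst p)) r T m (snd p)"
  have Y1: "(\<lambda>q. Y (snd q) (fst (fst q))) \<in> borel_measurable ((N \<Otimes>\<^sub>M borel) \<Otimes>\<^sub>M lborel)"
    using measurable_compose[of "\<lambda>q. (fst (fst q), snd q)" "(N \<Otimes>\<^sub>M borel) \<Otimes>\<^sub>M lborel" "N \<Otimes>\<^sub>M borel", OF _ assms]
    by simp
  have Y2: "(\<lambda>q. Y (snd (fst q)) (fst (fst q))) \<in> borel_measurable ((N \<Otimes>\<^sub>M borel) \<Otimes>\<^sub>M lborel)"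
    using measurable_compose[of fst "(N \<Otimes>\<^sub>M borel) \<Otimes>\<^sub>M lborel" "N \<Otimes>\<^sub>M borel", OF _ assms]
    by simp
  have C: "(\<lambda>q. chain (\<lambda>s. Y s (fst (fst q))) r T m (snd q)) \<in> borel_measurable ((N \<Otimes>\<^sub>M borel) \<Otimes>\<^sub>M lborel)"
    using measurable_compose[of "\<lambda>q. (fst (fst q), snd q)" "(N \<Otimes>\<^sub>M borel) \<Otimes>\<^sub>M lborel" "N \<Otimes>\<^sub>M borel", OF _ Suc]
    by simp
  \<comment> \<open>The range of integration moves with \<open>t\<close>, so its indicator has to be
    measurable in the pair (t, s).\<close>
  have I: "{(t, s). t < s \<and> s < T} \<in> sets (borel \<Otimes>\<^sub>M borel)"
  proof -
    have "{p \<in> space (borel \<Otimes>\<^sub>M borel). fst p < snd p \<and> snd p < T} \<in> sets (borel \<Otimes>\<^sub>M borel)"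
      by measurable
    moreover have "{p \<in> space (borel \<Otimes>\<^sub>M borel). fst p < snd p \<and> snd p < T} = {(t, s). t < s \<and> s < T}"
      by (auto simp: space_pair_measure)
    ultimately show ?thesis by simp
  qed
  let ?F = "\<lambda>p s. indicator {x. \<bar>x\<bar> \<le> r} (Y s (fst p) - Y (snd p) (fst p))
        * chain (\<lambda>s. Y s (fst p)) r T m s * (indicator {snd p<..<T} s :: ennreal)"
  have ind: "(indicator {snd p<..<T} s :: ennreal) = indicator {(t, s). t < s \<and> s < T} (snd p, s)" for p :: "'a \<times> real" and s
    by (auto simp: indicator_def)
  have "(\<lambda>q. ?F (fst q) (snd q)) \<in> borel_measurable ((N \<Otimes>\<^sub>M borel) \<Otimes>\<^sub>M lborel)"
    unfolding ind
    by (intro borel_measurable_times_ennreal C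
          measurable_compose[OF _ borel_measurable_indicator[OF I]]
          measurable_compose[OF borel_measurable_diff[OF Y1 Y2] borel_measurable_indicator]) measurable
  then have "case_prod ?F \<in> borel_measurable ((N \<Otimes>\<^sub>M borel) \<Otimes>\<^sub>M lborel)"
    by (simp only: split_beta')
  from lborel.borel_measurable_nn_integral[OF this]
  show ?case by (simp only: chain.simps)
qed simp

section \<open>Powers of occupation times as lower bounds for chains\<close>

lemma bounded_Int_fmeasurable:
  fixes A :: "real set"
  assumes "A \<in> sets borel"
  shows "A \<inter> {u<..<v} \<in> fmeasurable lborel"
proof (rule fmeasurableI2)
  show "{u..v} \<in> fmeasurable lborel"
    using fmeasurable_cbox[of u v] by simp
qed (use assms in auto)

text \<open>The measure still ahead is a 1-Lipschitz function of the left endpoint and falls to 0 at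
  \<open>T\<close>, so the intermediate value theorem yields a median.\<close>

lemma bisect_measure:
  fixes A :: "real set"
  assumes A: "A \<in> sets borel" and "t \<le> T"
  obtains s where "t \<le> s" "s \<le> T" "measure lborel (A \<inter> {s<..<T}) = measure lborel (A \<inter> {t<..<T}) / 2"
    "measure lborel (A \<inter> {t<..<s}) = measure lborel (A \<inter> {t<..<T}) / 2"
proof -
  define \<phi> where "\<phi> s = measure lborel (A \<inter> {s<..<T})" for s
  have split: "\<phi> u = measure lborel (A \<inter> {u<..<v}) + \<phi> v" if "u \<le> v" "v \<le> T" for u v
  proof -
    note fin = bounded_Int_fmeasurable[OF A]
    \<comment> \<open>The point \<open>v\<close> lies in neither piece, so the two sets agree only
      up to a null set.\<close>
    have "\<phi> u = measure lborel ((A \<inter> {u<..<v}) \<union> (A \<inter> {v<..<T}))"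
      unfolding \<phi>_def
    proof (rule measure_eq_AE)
      show "AE x in lborel. (x \<in> A \<inter> {u<..<T}) = (x \<in> A \<inter> {u<..<v} \<union> A \<inter> {v<..<T})"
        by (rule AE_mp[OF AE_lborel_singleton[of v]]) (use that in auto)
    qed (use A in auto)
    also have "\<dots> = measure lborel (A \<inter> {u<..<v}) + \<phi> v - measure lborel ((A \<inter> {u<..<v}) \<inter> (A \<inter> {v<..<T}))"
      unfolding \<phi>_def by (rule measure_Un3[OF fin fin])
    also have "(A \<inter> {u<..<v}) \<inter> (A \<inter> {v<..<T}) = {}" by auto
    finally show ?thesis by simp
  qed
  have lip: "\<bar>\<phi> u - \<phi> v\<bar> \<le> \<bar>u - v\<bar>" if "u \<le> T" "v \<le> T" for u v
  proof -
    have *: "\<bar>\<phi> u - \<phi> v\<bar> \<le> \<bar>u - v\<bar>" if "u \<le> v" "v \<le> T" for u v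
    proof -
      have "measure lborel (A \<inter> {u<..<v}) \<le> measure lborel {u..v}"
        by (rule measure_mono_fmeasurable) (use A fmeasurable_cbox[of u v] in auto)
      with split[OF that] that show ?thesis by (simp add: measure_nonneg abs_if)
    qed
    show ?thesis
      using *[of u v] *[of v u] that by (cases "u \<le> v") auto
  qed
  have "1-lipschitz_on {t..T} \<phi>"
    by (rule lipschitz_onI) (use lip in \<open>auto simp: dist_real_def\<close>)
  then have "continuous_on {t..T} \<phi>" by (rule lipschitz_on_continuous_on)
  moreover have "\<phi> T \<le> \<phi> t / 2" "\<phi> t / 2 \<le> \<phi> t"
    by (auto simp: \<phi>_def)
  ultimately obtain s where s: "t \<le> s" "s \<le> T" "\<phi> s = \<phi> t / 2"
    using IVT2'[of \<phi> T "\<phi> t / 2" t] \<open>t \<le> T\<close> by blast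
  with split[of t s] show thesis
    by (intro that[of s]) (auto simp: \<phi>_def)
qed

text \<open>Every increasing tuple in \<open>A\<close> between \<open>t\<close> and \<open>T\<close>
  is an admissible chain, so the sharp constant would be 1 / m!. Halving gives a cruder product:
  placing the next time before the median costs a factor 1/2 for that time and another for each of
  the \<open>m\<close> remaining powers, hence \<open>2 ^ Suc m\<close>.\<close>

lemma occupation_power_le_chain:
  assumes A[measurable]: "A \<in> sets borel"
    and r: "\<And>u v. u \<in> A \<Longrightarrow> v \<in> A \<Longrightarrow> \<bar>y u - y v\<bar> \<le> r"
    and t: "t \<in> A"
  shows "ennreal ((\<Prod>i<m. 1 / 2 ^ Suc i) * measure lborel (A \<inter> {t<..<T}) ^ m) \<le> chain y r T m t"
  using t
proof (induction m arbitrary: t)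
  case 0
  show ?case by simp
next
  case (Suc m)
  define c :: real where "c = (\<Prod>i<m. 1 / 2 ^ Suc i)"
  have c: "c > 0" unfolding c_def by (intro prod_pos) auto
  note IH = Suc.IH[folded c_def] and t = Suc.prems
  let ?\<phi> = "\<lambda>s. measure lborel (A \<inter> {s<..<T})"
  have "ennreal (c / 2 ^ Suc m * ?\<phi> t ^ Suc m) \<le> chain y r T (Suc m) t"
  proof (cases "t \<le> T")
    case True
    \<comment> \<open>Choose the next point of the chain before the median \<open>s0\<close> of the remaining occupation time:
      at least half of that time is still ahead of it.\<close>
    from bisect_measure[OF A True] obtain s0 where s0: "t \<le> s0" "s0 \<le> T" "?\<phi> s0 = ?\<phi> t / 2"
      "measure lborel (A \<inter> {t<..<s0}) = ?\<phi> t / 2" .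
    note fm = bounded_Int_fmeasurable[OF A]
    have "ennreal (c / 2 ^ Suc m * ?\<phi> t ^ Suc m) = ennreal (c * ?\<phi> s0 ^ m * measure lborel (A \<inter> {t<..<s0}))"
      unfolding s0 by (simp add: power_divide mult_ac)
    also have "\<dots> = ennreal (c * ?\<phi> s0 ^ m) * emeasure lborel (A \<inter> {t<..<s0})"
      using c emeasure_eq_measure2[OF fm[of t s0]] by (simp add: ennreal_mult)
    also have "\<dots> = (\<integral>\<^sup>+ s. ennreal (c * ?\<phi> s0 ^ m) * indicator (A \<inter> {t<..<s0}) s \<partial>lborel)"
      by (subst nn_integral_cmult_indicator) auto
    also have "\<dots> \<le> chain y r T (Suc m) t"
      unfolding chain.simps
    proof (rule nn_integral_mono)
      fix s
      have "ennreal (c * ?\<phi> s0 ^ m) \<le> chain y r T m s" if "s \<in> A" "s < s0"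
      proof -
        have "?\<phi> s0 \<le> ?\<phi> s"
          by (rule measure_mono_fmeasurable[OF _ _ fm]) (use that in auto)
        then have "ennreal (c * ?\<phi> s0 ^ m) \<le> ennreal (c * ?\<phi> s ^ m)"
          using c by (intro ennreal_leI mult_left_mono power_mono) auto
        also have "\<dots> \<le> chain y r T m s"
          using IH[OF that(1)] .
        finally show ?thesis .
      qed
      then show "ennreal (c * ?\<phi> s0 ^ m) * indicator (A \<inter> {t<..<s0}) s
        \<le> indicator {x. \<bar>x\<bar> \<le> r} (y s - y t) * chain y r T m s * indicator {t<..<T} s"
        using r[OF _ t, of s] s0(1,2) by (simp add: indicator_def)
    qed
    finally show ?thesis .
  qed (simp add: power_0_left)
  then show ?case by (simp add: c_def)
qed

section \<open>Chains of Brownian motion with drift\<close>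

text \<open>The cut-off \<open>max 0 t\<close> extends the paths continuously to negative times, where \<open>W\<close> is
  unconstrained.\<close>

definition drifted :: "real \<Rightarrow> real \<Rightarrow> (real \<Rightarrow> 'a \<Rightarrow> real) \<Rightarrow> real \<Rightarrow> 'a \<Rightarrow> real" where
  "drifted \<mu> \<sigma> W t \<omega> = \<mu> * t + \<sigma> * W (max 0 t) \<omega>"

lemma drifted_jointly_measurable:
  assumes "\<And>t. 0 \<le> t \<Longrightarrow> W t \<in> borel_measurable N"
    and "\<And>\<omega>. \<omega> \<in> space N \<Longrightarrow> continuous_on {0..} (\<lambda>t. W t \<omega>)"
  shows "(\<lambda>p. drifted \<mu> \<sigma> W (snd p) (fst p)) \<in> borel_measurable (N \<Otimes>\<^sub>M borel)"
proof (rule continuous_paths_jointly_measurable)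
  have [measurable]: "W (max 0 t) \<in> borel_measurable N" for t
    using assms(1) by simp
  show "drifted \<mu> \<sigma> W t \<in> borel_measurable N" for t
    unfolding drifted_def by measurable
  fix \<omega> assume "\<omega> \<in> space N"
  have "continuous_on UNIV ((\<lambda>t. W t \<omega>) \<circ> (\<lambda>t. max 0 t))"
    by (rule continuous_on_compose)
      (auto intro!: continuous_intros continuous_on_subset[OF assms(2)[OF \<open>\<omega> \<in> space N\<close>]])
  then show "continuous_on UNIV (\<lambda>t. drifted \<mu> \<sigma> W t \<omega>)"
    unfolding drifted_def by (auto intro!: continuous_intros simp: o_def)
qed

text \<open>This averages the singular price 1 / sqrt (s - t) of one link over its end time.
  Weakening sqrt (T - t) to sqrt T frees the bound from the start time, so that links can be
  integrated one after another.\<close>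

lemma nn_integral_inverse_sqrt_le:
  assumes "0 \<le> t"
  shows "(\<integral>\<^sup>+ s\<in>{t<..<T}. ennreal (1 / sqrt (s - t)) \<partial>lborel) \<le> ennreal (2 * sqrt T)"
proof (cases "t < T")
  case True
  have "((\<lambda>x. x powr (-1/2)) has_integral ((T - t) powr (-1/2 + 1) / (-1/2 + 1))) {0..T - t}"
    by (rule has_integral_powr_from_0) (use True in auto)
  then have I: "((\<lambda>x. x powr (-1/2)) has_integral (2 * sqrt (T - t))) {0..T - t}"
    using True by (simp add: powr_half_sqrt mult.commute)
  have "(\<integral>\<^sup>+ s\<in>{t<..<T}. ennreal (1 / sqrt (s - t)) \<partial>lborel)
      = (\<integral>\<^sup>+ s. ennreal (1 / sqrt s) * indicator {t<..<T} (t + s) \<partial>lborel)"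
    by (subst nn_integral_real_affine[where c=1 and t=t]) auto
  also have "\<dots> \<le> (\<integral>\<^sup>+ s. ennreal (s powr (-1/2)) * indicator {0..T - t} s \<partial>lborel)"
    by (rule nn_integral_mono) (auto simp: indicator_def powr_minus powr_half_sqrt inverse_eq_divide)
  also have "\<dots> = ennreal (2 * sqrt (T - t))"
    by (rule nn_integral_has_integral_lebesgue[OF _ I, THEN trans[rotated]])
      (auto intro!: nn_integral_cong simp: indicator_def)
  also have "\<dots> \<le> ennreal (2 * sqrt T)"
    using assms by (intro ennreal_leI) auto
  finally show ?thesis .
qed (simp add: not_less)

context
  fixes M :: "'a measure" and W :: "real \<Rightarrow> 'a \<Rightarrow> real" and \<mu> \<sigma> r :: real
  assumes bm: "standard_brownian_motion M W" and \<sigma>: "\<sigma> > 0" and r: "r > 0"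
begin

text \<open>Drift and scale turn the event into \<open>W t - W s\<close> lying in an interval of
  length 2 * r / \<sigma>, and the Gaussian density is at most its peak 1 / sqrt (2 * pi * (t -
  s)).\<close>

lemma emeasure_small_increment_le:
  assumes "0 \<le> s" "s < t"
  shows "emeasure M {\<omega> \<in> space M. \<bar>drifted \<mu> \<sigma> W t \<omega> - drifted \<mu> \<sigma> W s \<omega>\<bar> \<le> r}
    \<le> ennreal (r / \<sigma> * (1 / sqrt (t - s)))"
proof -
  define A where "A = {(- r - \<mu> * (t - s)) / \<sigma> .. (r - \<mu> * (t - s)) / \<sigma>}"
  have D: "distributed M lborel (\<lambda>\<omega>. W t \<omega> - W s \<omega>) (normal_density 0 (sqrt (t - s)))"
    using bm assms by (auto simp: standard_brownian_motion_def)
  have A: "x \<in> A \<longleftrightarrow> \<bar>\<mu> * (t - s) + \<sigma> * x\<bar> \<le> r" for x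
    using \<sigma> by (auto simp: A_def field_simps abs_le_iff)
  have "{\<omega> \<in> space M. \<bar>drifted \<mu> \<sigma> W t \<omega> - drifted \<mu> \<sigma> W s \<omega>\<bar> \<le> r}
      = (\<lambda>\<omega>. W t \<omega> - W s \<omega>) -` A \<inter> space M"
    using assms A by (auto simp: drifted_def algebra_simps)
  also have "emeasure M \<dots> = (\<integral>\<^sup>+ x\<in>A. ennreal (normal_density 0 (sqrt (t - s)) x) \<partial>lborel)"
    by (rule distributed_emeasure[OF D]) (auto simp: A_def)
  also have "\<dots> \<le> (\<integral>\<^sup>+ x. ennreal (1 / sqrt (2 * pi * (t - s))) * indicator A x \<partial>lborel)"
    using assms by (intro nn_integral_mono mult_right_mono ennreal_leI)
      (auto simp: normal_density_def divide_right_mono)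
  also have "\<dots> = ennreal (1 / sqrt (2 * pi * (t - s))) * ennreal (2 * r / \<sigma>)"
  proof -
    have "emeasure lborel A = ennreal (2 * r / \<sigma>)"
      using r \<sigma> unfolding A_def
      by (subst emeasure_lborel_Icc) (auto simp: divide_right_mono simp flip: diff_divide_distrib)
    then show ?thesis
      by (subst nn_integral_cmult_indicator) (auto simp: A_def)
  qed
  also have "\<dots> = ennreal (1 / sqrt (2 * pi * (t - s)) * (2 * r / \<sigma>))"
    using assms r \<sigma> by (subst ennreal_mult) auto
  also have "\<dots> \<le> ennreal (r / \<sigma> * (1 / sqrt (t - s)))"
  proof (rule ennreal_leI)
    \<comment> \<open>This absorbs the factor 2 of the interval length into the peak of the
      density.\<close>
    have "2 \<le> sqrt (2 * pi)"
      using pi_ge_two by (intro real_le_rsqrt) auto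
    then have "2 / sqrt (2 * pi) \<le> 1" by (simp add: field_simps)
    then have "2 / sqrt (2 * pi) * (r / \<sigma> * (1 / sqrt (t - s))) \<le> 1 * (r / \<sigma> * (1 / sqrt (t - s)))"
      by (rule mult_right_mono) (use assms r \<sigma> in auto)
    moreover have "1 / sqrt (2 * pi * (t - s)) * (2 * r / \<sigma>) = 2 / sqrt (2 * pi) * (r / \<sigma> * (1 / sqrt (t - s)))"
      unfolding real_sqrt_mult[of "2 * pi"] by simp
    ultimately show "1 / sqrt (2 * pi * (t - s)) * (2 * r / \<sigma>) \<le> r / \<sigma> * (1 / sqrt (t - s))"
      by (simp only: mult_1)
  qed
  finally show ?thesis .
qed

text \<open>Each drifted increment is a function of the corresponding Brownian one, so the product
  consists of independent factors and its expectation factorises.\<close>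

lemma expectation_small_increments_le:
  assumes "0 \<le> \<tau> 0" and "\<And>i. i < n \<Longrightarrow> \<tau> i < \<tau> (Suc i)"
  shows "(\<integral>\<^sup>+ \<omega>. (\<Prod>i<n. indicator {x. \<bar>x\<bar> \<le> r} (drifted \<mu> \<sigma> W (\<tau> (Suc i)) \<omega> - drifted \<mu> \<sigma> W (\<tau> i) \<omega>)) \<partial>M)
    \<le> (\<Prod>i<n. ennreal (r / \<sigma> * (1 / sqrt (\<tau> (Suc i) - \<tau> i))))"
proof -
  interpret prob_space M using bm by (simp add: standard_brownian_motion_def)
  have pos: "0 \<le> \<tau> i" if "i \<le> n" for i
    using that
  proof (induction i)
    case (Suc i)
    then show ?case using assms(2)[of i] by simp
  qed (use assms in simp)
  define f where "f i x = (indicator {x. \<bar>\<mu> * (\<tau> (Suc i) - \<tau> i) + \<sigma> * x\<bar> \<le> r} x :: ennreal)" for i x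
  have f: "indicator {x. \<bar>x\<bar> \<le> r} (drifted \<mu> \<sigma> W (\<tau> (Suc i)) \<omega> - drifted \<mu> \<sigma> W (\<tau> i) \<omega>)
      = f i (W (\<tau> (Suc i)) \<omega> - W (\<tau> i) \<omega>)" if "i < n" for i \<omega>
    using pos[of i] pos[of "Suc i"] that
    by (auto simp: f_def drifted_def indicator_def algebra_simps)
  have "indep_vars (\<lambda>_. borel) (\<lambda>i \<omega>. W (\<tau> (Suc i)) \<omega> - W (\<tau> i) \<omega>) {..<n}"
    using bm assms by (auto simp: standard_brownian_motion_def)
  then have "indep_vars (\<lambda>_. borel) (\<lambda>i \<omega>. f i (W (\<tau> (Suc i)) \<omega> - W (\<tau> i) \<omega>)) {..<n}"
    by (rule indep_vars_compose2) (simp add: f_def)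
  then have "(\<integral>\<^sup>+ \<omega>. (\<Prod>i<n. f i (W (\<tau> (Suc i)) \<omega> - W (\<tau> i) \<omega>)) \<partial>M)
      = (\<Prod>i<n. \<integral>\<^sup>+ \<omega>. f i (W (\<tau> (Suc i)) \<omega> - W (\<tau> i) \<omega>) \<partial>M)"
    by (intro indep_vars_nn_integral) auto
  also have "\<dots> \<le> (\<Prod>i<n. ennreal (r / \<sigma> * (1 / sqrt (\<tau> (Suc i) - \<tau> i))))"
  proof (rule prod_mono_ennreal)
    fix i assume "i \<in> {..<n}"
    then have i: "i < n" by simp
    have [measurable]: "W (\<tau> (Suc i)) \<in> borel_measurable M" "W (\<tau> i) \<in> borel_measurable M"
      using bm pos[of i] pos[of "Suc i"] i by (auto simp: standard_brownian_motion_def)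
    have "(\<integral>\<^sup>+ \<omega>. f i (W (\<tau> (Suc i)) \<omega> - W (\<tau> i) \<omega>) \<partial>M)
       = (\<integral>\<^sup>+ \<omega>. indicator {\<omega> \<in> space M. \<bar>drifted \<mu> \<sigma> W (\<tau> (Suc i)) \<omega> - drifted \<mu> \<sigma> W (\<tau> i) \<omega>\<bar> \<le> r} \<omega> \<partial>M)"
      by (rule nn_integral_cong) (simp flip: f[OF i] add: indicator_def)
    also have "\<dots> = emeasure M {\<omega> \<in> space M. \<bar>drifted \<mu> \<sigma> W (\<tau> (Suc i)) \<omega> - drifted \<mu> \<sigma> W (\<tau> i) \<omega>\<bar> \<le> r}"
      using pos[of i] pos[of "Suc i"] i by (intro nn_integral_indicator) (simp add: drifted_def)
    also have "\<dots> \<le> ennreal (r / \<sigma> * (1 / sqrt (\<tau> (Suc i) - \<tau> i)))"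
      using emeasure_small_increment_le pos[of i] assms(2)[OF i] i by simp
    finally show "(\<integral>\<^sup>+ \<omega>. f i (W (\<tau> (Suc i)) \<omega> - W (\<tau> i) \<omega>) \<partial>M)
       \<le> ennreal (r / \<sigma> * (1 / sqrt (\<tau> (Suc i) - \<tau> i)))" .
  qed
  finally show ?thesis using f by simp
qed

text \<open>The statement is generalised for the induction: the first \<open>n\<close> links join
  fixed times, the last \<open>m\<close> are still integrated. Independence is available for fixed
  times only, so each step uses Fubini to move one integrated time into \<tau>. Pure chains are the
  case n = 0.\<close>

lemma expectation_increments_chain_le:
  assumes "0 \<le> \<tau> 0" and "\<And>i. i < n \<Longrightarrow> \<tau> i < \<tau> (Suc i)"
  shows "(\<integral>\<^sup>+ \<omega>. (\<Prod>i<n. indicator {x. \<bar>x\<bar> \<le> r} (drifted \<mu> \<sigma> W (\<tau> (Suc i)) \<omega> - drifted \<mu> \<sigma> W (\<tau> i) \<omega>))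
        * chain (\<lambda>s. drifted \<mu> \<sigma> W s \<omega>) r T m (\<tau> n) \<partial>M)
    \<le> (\<Prod>i<n. ennreal (r / \<sigma> * (1 / sqrt (\<tau> (Suc i) - \<tau> i)))) * ennreal (r / \<sigma> * (2 * sqrt T)) ^ m"
  using assms
proof (induction m arbitrary: n \<tau>)
  case 0
  then show ?case using expectation_small_increments_le by simp
next
  case (Suc m)
  interpret prob_space M using bm by (simp add: standard_brownian_motion_def)
  interpret L: pair_sigma_finite M lborel ..
  let ?Y = "drifted \<mu> \<sigma> W"
  let ?I = "indicator {x. \<bar>x\<bar> \<le> r} :: real \<Rightarrow> ennreal"
  let ?P = "\<lambda>\<omega>. \<Prod>i<n. ?I (?Y (\<tau> (Suc i)) \<omega> - ?Y (\<tau> i) \<omega>)"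
  let ?p = "\<Prod>i<n. ennreal (r / \<sigma> * (1 / sqrt (\<tau> (Suc i) - \<tau> i)))"
  let ?K = "ennreal (r / \<sigma> * (2 * sqrt T))"
  have pos: "0 \<le> \<tau> i" if "i \<le> n" for i
    using that
  proof (induction i)
    case (Suc i)
    then show ?case using Suc.prems(1) \<open>\<And>i. i < n \<Longrightarrow> \<tau> i < \<tau> (Suc i)\<close>[of i] by simp
  qed (use Suc.prems in simp)
  have W: "\<And>t. 0 \<le> t \<Longrightarrow> W t \<in> borel_measurable M"
      "\<And>\<omega>. \<omega> \<in> space M \<Longrightarrow> continuous_on {0..} (\<lambda>t. W t \<omega>)"
    using bm by (auto simp: standard_brownian_motion_def)
  have Wm: "W (max 0 t) \<in> borel_measurable M" for t using W(1) by simp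
  have Y[measurable]: "?Y t \<in> borel_measurable M" for t
    unfolding drifted_def using Wm[of t] by measurable
  have Yj: "(\<lambda>p. ?Y (snd p) (fst p)) \<in> borel_measurable (M \<Otimes>\<^sub>M lborel)"
    using drifted_jointly_measurable[OF W] by (simp cong: measurable_cong_sets)
  have Cj: "(\<lambda>p. chain (\<lambda>s. ?Y s (fst p)) r T m (snd p)) \<in> borel_measurable (M \<Otimes>\<^sub>M lborel)"
    using chain_jointly_measurable[OF drifted_jointly_measurable[OF W]] by (simp cong: measurable_cong_sets)
  let ?g = "\<lambda>p. ?P (fst p) * (?I (?Y (snd p) (fst p) - ?Y (\<tau> n) (fst p)) * chain (\<lambda>s. ?Y s (fst p)) r T m (snd p)
       * indicator {\<tau> n<..<T} (snd p))"
  have g: "?g \<in> borel_measurable (M \<Otimes>\<^sub>M lborel)"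
    by (intro borel_measurable_times_ennreal Cj borel_measurable_prod
          measurable_compose[OF borel_measurable_diff[OF Yj] borel_measurable_indicator]) measurable
  have "(\<integral>\<^sup>+ \<omega>. ?P \<omega> * chain (\<lambda>s. ?Y s \<omega>) r T (Suc m) (\<tau> n) \<partial>M)
     = (\<integral>\<^sup>+ \<omega>. (\<integral>\<^sup>+ s. ?g (\<omega>, s) \<partial>lborel) \<partial>M)"
  proof (rule nn_integral_cong)
    fix \<omega> assume "\<omega> \<in> space M"
    have [measurable]: "(\<lambda>s. ?Y s \<omega>) \<in> borel_measurable lborel"
      "(\<lambda>s. chain (\<lambda>s. ?Y s \<omega>) r T m s) \<in> borel_measurable lborel"
      using measurable_compose[OF measurable_Pair1'[OF \<open>\<omega> \<in> space M\<close>] Yj]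
        measurable_compose[OF measurable_Pair1'[OF \<open>\<omega> \<in> space M\<close>] Cj] by simp_all
    show "?P \<omega> * chain (\<lambda>s. ?Y s \<omega>) r T (Suc m) (\<tau> n) = (\<integral>\<^sup>+ s. ?g (\<omega>, s) \<partial>lborel)"
      unfolding chain.simps fst_conv snd_conv
      by (rule nn_integral_cmult[symmetric]) measurable
  qed
  also have "\<dots> = (\<integral>\<^sup>+ s. (\<integral>\<^sup>+ \<omega>. ?g (\<omega>, s) \<partial>M) \<partial>lborel)"
    by (rule L.Fubini'[symmetric]) (use g in \<open>simp add: split_beta'\<close>)
  also have "\<dots> \<le> (\<integral>\<^sup>+ s. (?p * ?K ^ m * ennreal (r / \<sigma>)) * (ennreal (1 / sqrt (s - \<tau> n)) * indicator {\<tau> n<..<T} s) \<partial>lborel)"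
  proof (rule nn_integral_mono)
    fix s
    show "(\<integral>\<^sup>+ \<omega>. ?g (\<omega>, s) \<partial>M) \<le> (?p * ?K ^ m * ennreal (r / \<sigma>)) * (ennreal (1 / sqrt (s - \<tau> n)) * indicator {\<tau> n<..<T} s)"
    proof (cases "\<tau> n < s \<and> s < T")
      case True
      \<comment> \<open>The integration variable becomes fixed time number \<open>Suc n\<close>, so
        the induction hypothesis applies with one link more and one integral fewer.\<close>
      define \<tau>' where "\<tau>' = \<tau>(Suc n := s)"
      have eq: "\<tau>' i = \<tau> i" if "i \<le> n" for i using that by (simp add: \<tau>'_def)
      have s: "\<tau>' (Suc n) = s" by (simp add: \<tau>'_def)
      have "(\<integral>\<^sup>+ \<omega>. ?g (\<omega>, s) \<partial>M)
         = (\<integral>\<^sup>+ \<omega>. (\<Prod>i<Suc n. ?I (?Y (\<tau>' (Suc i)) \<omega> - ?Y (\<tau>' i) \<omega>)) * chain (\<lambda>s. ?Y s \<omega>) r T m (\<tau>' (Suc n)) \<partial>M)"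
        using True by (intro nn_integral_cong) (simp add: eq s mult.assoc)
      also have "\<dots> \<le> (\<Prod>i<Suc n. ennreal (r / \<sigma> * (1 / sqrt (\<tau>' (Suc i) - \<tau>' i)))) * ?K ^ m"
        by (rule Suc.IH) (use Suc.prems True in \<open>auto simp: eq s less_Suc_eq\<close>)
      also have "\<dots> = ?p * ennreal (r / \<sigma> * (1 / sqrt (s - \<tau> n))) * ?K ^ m"
        by (simp add: eq s)
      also have "ennreal (r / \<sigma> * (1 / sqrt (s - \<tau> n))) = ennreal (r / \<sigma>) * ennreal (1 / sqrt (s - \<tau> n))"
        using True r \<sigma> by (intro ennreal_mult) auto
      finally show ?thesis using True by (simp add: mult_ac)
    qed auto
  qed
  also have "\<dots> = (?p * ?K ^ m * ennreal (r / \<sigma>)) * (\<integral>\<^sup>+ s\<in>{\<tau> n<..<T}. ennreal (1 / sqrt (s - \<tau> n)) \<partial>lborel)"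
    by (rule nn_integral_cmult) measurable
  also have "\<dots> \<le> (?p * ?K ^ m * ennreal (r / \<sigma>)) * ennreal (2 * sqrt T)"
    by (intro mult_left_mono nn_integral_inverse_sqrt_le pos) auto
  also have "\<dots> = ?p * ?K ^ m * (ennreal (r / \<sigma>) * ennreal (2 * sqrt T))"
    by (simp only: mult.assoc)
  also have "ennreal (r / \<sigma>) * ennreal (2 * sqrt T) = ?K"
    using r \<sigma> by (intro ennreal_mult'[symmetric]) simp
  also have "?p * ?K ^ m * ?K = ?p * ?K ^ Suc m"
    by (simp only: power_Suc mult_ac)
  finally show ?case .
qed

end

section \<open>Uniformly bounded potentials\<close>

lemma chain_cong:
  assumes "\<And>s. t \<le> s \<Longrightarrow> y s = y' s"
  shows "chain y r T m t = chain y' r T m t"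
  using assms
proof (induction m arbitrary: t)
  case (Suc m)
  have "chain y r T m s = chain y' r T m s" if "t < s" for s
    using that Suc.prems by (intro Suc.IH) auto
  then show ?case
    unfolding chain.simps using Suc.prems
    by (intro nn_integral_cong) (simp add: indicator_def)
qed simp

text \<open>The right-hand side does not mention \<open>c\<close>; all later uniformity over centres
  comes from here. Two occupied points carry values at most 2 * r apart, and one of the
  \<open>Suc m\<close> links is spent on reaching the first of them.\<close>

lemma occupation_power_le_integral_chain:
  fixes y :: "real \<Rightarrow> real"
  assumes y[measurable]: "y \<in> borel_measurable borel"
  shows "ennreal ((\<Prod>i<Suc m. 1 / 2 ^ Suc i) * measure lborel ({s. \<bar>y s - c\<bar> \<le> r} \<inter> {0<..<T}) ^ Suc m)
     \<le> (\<integral>\<^sup>+ t\<in>{0<..<T}. chain y (2 * r) T m t \<partial>lborel)"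
proof (cases "0 \<le> r")
  case True
  \<comment> \<open>Time \<open>0\<close> is added to the occupied set, so that chains may start there.\<close>
  define y' where "y' = y(0 := c)"
  define A where "A = {s. \<bar>y' s - c\<bar> \<le> r}"
  have y'[measurable]: "y' \<in> borel_measurable borel"
    unfolding y'_def fun_upd_def by measurable
  have A: "A \<in> sets borel" unfolding A_def by measurable
  have "{s. \<bar>y s - c\<bar> \<le> r} \<inter> {0<..<T} = A \<inter> {0<..<T}"
    by (auto simp: A_def y'_def)
  then have "ennreal ((\<Prod>i<Suc m. 1 / 2 ^ Suc i) * measure lborel ({s. \<bar>y s - c\<bar> \<le> r} \<inter> {0<..<T}) ^ Suc m)
     = ennreal ((\<Prod>i<Suc m. 1 / 2 ^ Suc i) * measure lborel (A \<inter> {0<..<T}) ^ Suc m)"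
    by simp
  also have "\<dots> \<le> chain y' (2 * r) T (Suc m) 0"
    by (rule occupation_power_le_chain[OF A]) (use True in \<open>auto simp: A_def y'_def\<close>)
  \<comment> \<open>Only the first link sees the altered value at time 0. Its indicator is at most
    1, and after time 0 the two paths agree.\<close>
  also have "\<dots> \<le> (\<integral>\<^sup>+ t\<in>{0<..<T}. chain y (2 * r) T m t \<partial>lborel)"
    unfolding chain.simps
  proof (rule nn_integral_mono)
    fix s
    have "chain y' (2 * r) T m s = chain y (2 * r) T m s" if "0 < s"
      using that by (intro chain_cong) (auto simp: y'_def)
    then show "indicator {x. \<bar>x\<bar> \<le> 2 * r} (y' s - y' 0) * chain y' (2 * r) T m s * indicator {0<..<T} s
      \<le> chain y (2 * r) T m s * indicator {0<..<T} s"
      by (simp add: indicator_def)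
  qed
  finally show ?thesis .
next
  case False
  then have "{s. \<bar>y s - c\<bar> \<le> r} = {}" by auto
  then show ?thesis by simp
qed

text \<open>The weight \<open>(b ^ Suc m) ^ k\<close> matches the power \<open>Suc m\<close> of the
  occupation time at radius (1 / 2) ^ k. Finite energy thus forces occupation times of order 1 / b ^
  k at all scales and centres simultaneously.\<close>

definition energy :: "(real \<Rightarrow> real) \<Rightarrow> real \<Rightarrow> real \<Rightarrow> nat \<Rightarrow> ennreal" where
  "energy y T b m = (\<Sum>k. ennreal ((b ^ Suc m) ^ k) * (\<integral>\<^sup>+ t\<in>{0<..<T}. chain y (2 * (1 / 2) ^ k) T m t \<partial>lborel))"

text \<open>The term of index \<open>k\<close> alone already dominates a constant times
  \<open>(b ^ k * \<nu>) ^ Suc m\<close>, where \<nu> is the occupation time. It remains to compare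
  powers with equal exponent.\<close>

lemma occupation_le_of_energy:
  fixes y :: "real \<Rightarrow> real"
  assumes y: "y \<in> borel_measurable borel"
    and b: "b > 0" and K: "energy y T b m \<le> ennreal K" "0 \<le> K"
  shows "measure lborel ({s. \<bar>y s - c\<bar> \<le> (1 / 2) ^ k} \<inter> {0<..<T})
     \<le> max 1 (K / (\<Prod>i<Suc m. 1 / 2 ^ Suc i)) / b ^ k"
proof -
  define C :: real where "C = (\<Prod>i<Suc m. 1 / 2 ^ Suc i)"
  have C: "C > 0" unfolding C_def by (intro prod_pos) auto
  define \<nu> where "\<nu> = measure lborel ({s. \<bar>y s - c\<bar> \<le> (1 / 2) ^ k} \<inter> {0<..<T})"
  have \<nu>: "0 \<le> \<nu>" by (simp add: \<nu>_def)
  define f where "f k = ennreal ((b ^ Suc m) ^ k) * (\<integral>\<^sup>+ t\<in>{0<..<T}. chain y (2 * (1 / 2) ^ k) T m t \<partial>lborel)" for k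
  have "ennreal ((b ^ Suc m) ^ k * (C * \<nu> ^ Suc m)) = ennreal ((b ^ Suc m) ^ k) * ennreal (C * \<nu> ^ Suc m)"
    using b by (intro ennreal_mult') simp
  also have "\<dots> \<le> f k"
    unfolding f_def C_def \<nu>_def
    by (intro mult_left_mono occupation_power_le_integral_chain[OF y]) simp
  also have "\<dots> = (\<Sum>i\<in>{k}. f i)" by simp
  also have "\<dots> \<le> (\<Sum>i. f i)" by (intro sum_le_suminf) auto
  also have "\<dots> \<le> ennreal K" using K(1) by (simp add: energy_def f_def)
  finally have "(b ^ Suc m) ^ k * (C * \<nu> ^ Suc m) \<le> K"
    using K(2) by (simp add: ennreal_le_iff)
  moreover have "(b ^ Suc m) ^ k = (b ^ k) ^ Suc m"
    by (metis power_mult mult.commute)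
  ultimately have "(b ^ k * \<nu>) ^ Suc m * C \<le> K"
    unfolding power_mult_distrib by (simp only: mult_ac)
  then have "(b ^ k * \<nu>) ^ Suc m \<le> K / C" using C by (simp add: pos_le_divide_eq)
  \<comment> \<open>A bound that is at least 1 is dominated by its own power, so no root has to
    appear in the constant.\<close>
  also have "\<dots> \<le> max 1 (K / C)" by simp
  also have "\<dots> \<le> max 1 (K / C) ^ Suc m"
    by (rule self_le_power) auto
  finally have "b ^ k * \<nu> \<le> max 1 (K / C)"
    by (rule power_le_imp_le_base) simp
  then show ?thesis
    unfolding \<nu>_def[symmetric] C_def[symmetric] using b by (simp add: pos_le_divide_eq mult.commute)
qed

text \<open>If |x| lies between (1 / 2) ^ (k + 1), excluded, and (1 / 2) ^ k, the term of index
  \<open>k\<close> alone suffices. The summand 1 covers |x| > 1 and \<alpha> = 0. At x = 0 with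
  \<alpha> > 0 every term is at least 1, so the series is infinite, as is inverse 0.\<close>

lemma intensity_le_dyadic:
  assumes "0 \<le> \<alpha>"
  shows "intensity lam \<alpha> x \<le> ennreal lam * (1 + (\<Sum>k. ennreal ((2 powr \<alpha>) ^ Suc k) * indicator {x. \<bar>x\<bar> \<le> (1 / 2) ^ k} x))"
proof -
  define f where "f k = (ennreal ((2 powr \<alpha>) ^ Suc k) * indicator {x. \<bar>x\<bar> \<le> (1 / 2) ^ k} x)" for k
  have f_le: "f k \<le> suminf f" for k
    using sum_le_suminf[of f "{k}"] by simp
  consider "\<alpha> = 0" | "\<alpha> > 0" "x = 0" | "\<alpha> > 0" "\<bar>x\<bar> > 1" | "\<alpha> > 0" "x \<noteq> 0" "\<bar>x\<bar> \<le> 1"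
    using assms by linarith
  then have "inverse (if \<alpha> = 0 then 1 else ennreal (\<bar>x\<bar> powr \<alpha>)) \<le> 1 + suminf f"
  proof cases
    case 2
    have "of_nat n \<le> suminf f" for n
    proof -
      have "of_nat n = (\<Sum>k<n. 1 :: ennreal)" by simp
      also have "\<dots> \<le> (\<Sum>k<n. f k)"
      proof (rule sum_mono)
        fix k
        have "1 \<le> (2 powr \<alpha>) ^ Suc k"
          using assms by (intro one_le_power) (simp add: ge_one_powr_ge_zero)
        then show "1 \<le> f k"
          using 2 ennreal_leI[of 1 "(2 powr \<alpha>) ^ Suc k"] by (simp add: f_def)
      qed
      also have "\<dots> \<le> suminf f" by (rule sum_le_suminf) auto
      finally show ?thesis .
    qed
    then have "suminf f = \<top>"
      using ennreal_Ex_less_of_nat[of "suminf f"] by (meson leD top.not_eq_extremum)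
    then show ?thesis by simp
  next
    case 3
    then have "1 \<le> \<bar>x\<bar> powr \<alpha>" by (simp add: ge_one_powr_ge_zero)
    then have "inverse (\<bar>x\<bar> powr \<alpha>) \<le> 1" by (simp add: inverse_le_1_iff)
    then have "ennreal (inverse (\<bar>x\<bar> powr \<alpha>)) \<le> 1" using ennreal_leI by fastforce
    also have "\<dots> \<le> 1 + suminf f" by simp
    finally show ?thesis using 3 by (simp add: inverse_ennreal)
  next
    case 4
    have "\<exists>k. (1/2) ^ Suc k < \<bar>x\<bar> \<and> \<bar>x\<bar> \<le> (1/2) ^ k"
    proof -
      obtain n where n: "(1/2) ^ n < \<bar>x\<bar>" using real_arch_pow_inv[of "\<bar>x\<bar>" "1/2"] 4 by auto
      define N where "N = (LEAST n. (1/2) ^ n < \<bar>x\<bar>)"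
      have N: "(1/2) ^ N < \<bar>x\<bar>" unfolding N_def by (rule LeastI[of _ n]) (rule n)
      moreover have "N \<noteq> 0" using N 4 by (intro notI) simp
      then obtain j where j: "N = Suc j" by (cases N) auto
      moreover have "\<not> (1/2) ^ j < \<bar>x\<bar>" using not_less_Least[of j "\<lambda>n. (1/2) ^ n < \<bar>x\<bar>"] j N_def by simp
      ultimately show ?thesis by auto
    qed
    then obtain k where k: "(1/2) ^ Suc k < \<bar>x\<bar>" "\<bar>x\<bar> \<le> (1/2) ^ k" by blast
    have "((1/2) powr \<alpha>) ^ n = ((1/2) ^ n) powr \<alpha>" for n
      by (induction n) (simp_all add: powr_divide powr_mult)
    then have "((1/2) powr \<alpha>) ^ Suc k = ((1/2) ^ Suc k) powr \<alpha>" .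
    also have "\<dots> \<le> \<bar>x\<bar> powr \<alpha>"
      using k(1) assms by (intro powr_mono2) auto
    finally have "((1/2) powr \<alpha>) ^ Suc k \<le> \<bar>x\<bar> powr \<alpha>" .
    then have "inverse (\<bar>x\<bar> powr \<alpha>) \<le> inverse (((1/2) powr \<alpha>) ^ Suc k)"
      by (intro le_imp_inverse_le) auto
    also have "\<dots> = (2 powr \<alpha>) ^ Suc k"
      by (simp add: power_inverse[symmetric] powr_divide del: power_Suc)
    finally have "ennreal (inverse (\<bar>x\<bar> powr \<alpha>)) \<le> f k"
      using k by (simp add: f_def ennreal_leI del: power_Suc)
    also have "\<dots> \<le> suminf f" by (rule f_le)
    also have "\<dots> \<le> 1 + suminf f" by simp
    finally show ?thesis using 4 by (simp add: inverse_ennreal)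
  qed simp
  then have "ennreal lam * inverse (if \<alpha> = 0 then 1 else ennreal (\<bar>x\<bar> powr \<alpha>)) \<le> ennreal lam * (1 + suminf f)"
    by (rule mult_left_mono) simp
  then show ?thesis by (simp only: intensity_def divide_ennreal_def f_def[abs_def])
qed

text \<open>\<open>N\<close> is general because the lemma serves both for \<open>M\<close> and for
  the sigma-algebra of the past together with the noise.\<close>

lemma energy_measurable:
  assumes "\<And>t. 0 \<le> t \<Longrightarrow> W t \<in> borel_measurable N"
    and "\<And>\<omega>. \<omega> \<in> space N \<Longrightarrow> continuous_on {0..} (\<lambda>t. W t \<omega>)"
  shows "(\<lambda>\<omega>. energy (\<lambda>s. drifted \<mu> \<sigma> W s \<omega>) T b m) \<in> borel_measurable N"
  unfolding energy_def
proof (intro borel_measurable_suminf_order borel_measurable_times_ennreal borel_measurable_const)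
  fix k
  have "(\<lambda>p. chain (\<lambda>s. drifted \<mu> \<sigma> W s (fst p)) (2 * (1 / 2) ^ k) T m (snd p)) \<in> borel_measurable (N \<Otimes>\<^sub>M lborel)"
    using chain_jointly_measurable[OF drifted_jointly_measurable[OF assms]] by (simp cong: measurable_cong_sets)
  then have "(\<lambda>p. chain (\<lambda>s. drifted \<mu> \<sigma> W s (fst p)) (2 * (1 / 2) ^ k) T m (snd p) * indicator {0<..<T} (snd p)) \<in> borel_measurable (N \<Otimes>\<^sub>M lborel)"
    by (rule borel_measurable_times_ennreal) measurable
  from lborel.borel_measurable_nn_integral[of "\<lambda>\<omega> t. chain (\<lambda>s. drifted \<mu> \<sigma> W s \<omega>) (2 * (1 / 2) ^ k) T m t * indicator {0<..<T} t" N] this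
  show "(\<lambda>\<omega>. \<integral>\<^sup>+ t\<in>{0<..<T}. chain (\<lambda>s. drifted \<mu> \<sigma> W s \<omega>) (2 * (1 / 2) ^ k) T m t \<partial>lborel) \<in> borel_measurable N"
    by (simp add: split_beta')
qed

text \<open>The expected energy is finite: its k-th term has expectation at most a constant times q
  ^ k, where q = b ^ Suc m / 2 ^ m < 1.\<close>

lemma AE_energy_finite:
  assumes bm: "standard_brownian_motion M W" and \<sigma>: "\<sigma> > 0" and T: "0 \<le> T"
    and b: "b > 0" "b ^ Suc m < 2 ^ m"
  shows "AE \<omega> in M. energy (\<lambda>s. drifted \<mu> \<sigma> W s \<omega>) T b m < \<infinity>"
proof -
  interpret prob_space M using bm by (simp add: standard_brownian_motion_def)
  interpret L: pair_sigma_finite M lborel ..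
  have W: "\<And>t. 0 \<le> t \<Longrightarrow> W t \<in> borel_measurable M"
      "\<And>\<omega>. \<omega> \<in> space M \<Longrightarrow> continuous_on {0..} (\<lambda>t. W t \<omega>)"
    using bm by (auto simp: standard_brownian_motion_def)
  let ?C = "\<lambda>k \<omega> t. chain (\<lambda>s. drifted \<mu> \<sigma> W s \<omega>) (2 * (1 / 2) ^ k) T m t"
  \<comment> \<open>\<open>D\<close> collects the constants of one link: radius 2 * (1 / 2) ^ k and
    the time integral 2 * sqrt T together give D * (1 / 2) ^ k.\<close>
  define D where "D = 4 * sqrt T / \<sigma>"
  have D: "0 \<le> D" using T \<sigma> by (simp add: D_def)
  have Cj: "(\<lambda>p. ?C k (fst p) (snd p) * indicator {0<..<T} (snd p)) \<in> borel_measurable (M \<Otimes>\<^sub>M lborel)" for k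
    using chain_jointly_measurable[OF drifted_jointly_measurable[OF W]]
    by (intro borel_measurable_times_ennreal) (simp_all cong: measurable_cong_sets)
  have int_m: "(\<lambda>\<omega>. \<integral>\<^sup>+ t\<in>{0<..<T}. ?C k \<omega> t \<partial>lborel) \<in> borel_measurable M" for k
    using lborel.borel_measurable_nn_integral[of "\<lambda>\<omega> t. ?C k \<omega> t * indicator {0<..<T} t" M] Cj
    by (simp add: split_beta')
  have *: "(\<integral>\<^sup>+ \<omega>. (\<integral>\<^sup>+ t\<in>{0<..<T}. ?C k \<omega> t \<partial>lborel) \<partial>M) \<le> ennreal (T * (D * (1 / 2) ^ k) ^ m)" for k
  proof -
    have "(\<integral>\<^sup>+ \<omega>. (\<integral>\<^sup>+ t\<in>{0<..<T}. ?C k \<omega> t \<partial>lborel) \<partial>M)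
      = (\<integral>\<^sup>+ t. (\<integral>\<^sup>+ \<omega>. ?C k \<omega> t * indicator {0<..<T} t \<partial>M) \<partial>lborel)"
      by (rule L.Fubini'[symmetric]) (use Cj in \<open>simp add: split_beta'\<close>)
    also have "\<dots> \<le> (\<integral>\<^sup>+ t. ennreal ((D * (1 / 2) ^ k) ^ m) * indicator {0<..<T} t \<partial>lborel)"
    proof (rule nn_integral_mono)
      fix t
      have "(\<integral>\<^sup>+ \<omega>. ?C k \<omega> t \<partial>M) \<le> ennreal ((D * (1 / 2) ^ k) ^ m)" if "0 < t"
      proof -
        have "(\<integral>\<^sup>+ \<omega>. ?C k \<omega> t \<partial>M) \<le> ennreal (2 * (1 / 2) ^ k / \<sigma> * (2 * sqrt T)) ^ m"
          using expectation_increments_chain_le[OF bm \<sigma>, of "2 * (1 / 2) ^ k" "\<lambda>_. t" 0 \<mu> T m] that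
          by simp
        also have "\<dots> = ennreal ((2 * (1 / 2) ^ k / \<sigma> * (2 * sqrt T)) ^ m)"
          using T \<sigma> by (intro ennreal_power) simp
        also have "2 * (1 / 2) ^ k / \<sigma> * (2 * sqrt T) = D * (1 / 2) ^ k"
          by (simp add: D_def)
        finally show ?thesis .
      qed
      then show "(\<integral>\<^sup>+ \<omega>. ?C k \<omega> t * indicator {0<..<T} t \<partial>M) \<le> ennreal ((D * (1 / 2) ^ k) ^ m) * indicator {0<..<T} t"
        by (simp add: indicator_def)
    qed
    also have "\<dots> = ennreal ((D * (1 / 2) ^ k) ^ m) * ennreal T"
      using T by (subst nn_integral_cmult_indicator) auto
    also have "\<dots> = ennreal ((D * (1 / 2) ^ k) ^ m * T)"
      using T D by (intro ennreal_mult[symmetric]) auto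
    finally show ?thesis by (simp add: mult.commute)
  qed
  define q where "q = b ^ Suc m / 2 ^ m"
  have q: "0 \<le> q" "q < 1" using b by (auto simp: q_def)
  have "(\<integral>\<^sup>+ \<omega>. energy (\<lambda>s. drifted \<mu> \<sigma> W s \<omega>) T b m \<partial>M)
     = (\<Sum>k. \<integral>\<^sup>+ \<omega>. ennreal ((b ^ Suc m) ^ k) * (\<integral>\<^sup>+ t\<in>{0<..<T}. ?C k \<omega> t \<partial>lborel) \<partial>M)"
    unfolding energy_def by (intro nn_integral_suminf borel_measurable_times_ennreal int_m borel_measurable_const)
  also have "\<dots> = (\<Sum>k. ennreal ((b ^ Suc m) ^ k) * (\<integral>\<^sup>+ \<omega>. (\<integral>\<^sup>+ t\<in>{0<..<T}. ?C k \<omega> t \<partial>lborel) \<partial>M))"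
    by (intro arg_cong[where f=suminf] ext nn_integral_cmult int_m)
  also have "\<dots> \<le> (\<Sum>k. ennreal (T * D ^ m * q ^ k))"
  proof (rule suminf_le)
    fix k
    have "ennreal ((b ^ Suc m) ^ k) * (\<integral>\<^sup>+ \<omega>. (\<integral>\<^sup>+ t\<in>{0<..<T}. ?C k \<omega> t \<partial>lborel) \<partial>M)
      \<le> ennreal ((b ^ Suc m) ^ k) * ennreal (T * (D * (1 / 2) ^ k) ^ m)"
      by (intro mult_left_mono *) simp
    also have "\<dots> = ennreal ((b ^ Suc m) ^ k * (T * (D * (1 / 2) ^ k) ^ m))"
      using b by (intro ennreal_mult'[symmetric]) simp
    also have "(b ^ Suc m) ^ k * (T * (D * (1 / 2) ^ k) ^ m) = T * D ^ m * q ^ k"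
    proof -
      have "((1 / 2) ^ k) ^ m = ((1 / 2 :: real) ^ m) ^ k" by (metis power_mult mult.commute)
      then show ?thesis
        by (simp add: q_def power_mult_distrib power_divide del: power_Suc)
    qed
    finally show "ennreal ((b ^ Suc m) ^ k) * (\<integral>\<^sup>+ \<omega>. (\<integral>\<^sup>+ t\<in>{0<..<T}. ?C k \<omega> t \<partial>lborel) \<partial>M) \<le> ennreal (T * D ^ m * q ^ k)" .
  qed auto
  also have "\<dots> < \<infinity>"
  proof -
    have "summable (\<lambda>k. T * D ^ m * q ^ k)"
      using q by (intro summable_mult summable_geometric) simp
    then have "(\<Sum>k. ennreal (T * D ^ m * q ^ k)) \<noteq> \<top>"
      using T D q by (intro ennreal_suminf_neq_top) auto
    then show ?thesis by (simp add: top.not_eq_extremum)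
  qed
  finally have "(\<integral>\<^sup>+ \<omega>. energy (\<lambda>s. drifted \<mu> \<sigma> W s \<omega>) T b m \<partial>M) \<noteq> \<infinity>" by simp
  from nn_integral_noteq_infinite[OF energy_measurable[OF W] this]
  show ?thesis by (simp add: less_top)
qed

text \<open>\<open>B\<close> is chosen before \<open>y\<close> and \<open>c\<close>. The occupation
  bound centred at - c, inserted into the dyadic bound, makes the contribution of scale
  \<open>k\<close> of order (2 powr \<alpha> / b) ^ k, a convergent geometric series.\<close>

lemma potential_bounded_of_energy:
  assumes \<alpha>: "0 \<le> \<alpha>" and b: "2 powr \<alpha> < b"
  obtains B where "B \<ge> 0" "\<And>y c. y \<in> borel_measurable borel \<Longrightarrow> energy y T b m \<le> ennreal K \<Longrightarrow>
    (\<integral>\<^sup>+ s\<in>{0..T}. intensity lam \<alpha> (c + y s) \<partial>lborel) \<le> ennreal B"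
proof -
  \<comment> \<open>Since \<open>ennreal K\<close> is 0 for negative \<open>K\<close>, the
    occupation bound is applied with \<open>max 0 K\<close>.\<close>
  define D where "D = max 1 (max 0 K / (\<Prod>i<Suc m. 1 / 2 ^ Suc i))"
  define a :: real where "a = 2 powr \<alpha>"
  have a: "0 < a" "a < b" using b by (auto simp: a_def)
  define S where "S = (\<Sum>k. a ^ Suc k * (D / b ^ k))"
  have D: "0 \<le> D" by (simp add: D_def)
  have sm: "summable (\<lambda>k. a ^ Suc k * (D / b ^ k))"
  proof -
    have "a ^ Suc k * (D / b ^ k) = a * D * (a / b) ^ k" for k
      by (simp add: power_divide)
    moreover have "summable (\<lambda>k. a * D * (a / b) ^ k)"
      using a by (intro summable_mult summable_geometric) simp
    ultimately show ?thesis by simp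
  qed
  show thesis
  proof (rule that[of "max 0 lam * (max 0 T + S)"])
    have S: "0 \<le> S" unfolding S_def using a D by (intro suminf_nonneg sm) auto
    then show "0 \<le> max 0 lam * (max 0 T + S)" by simp
    fix y :: "real \<Rightarrow> real" and c
    assume y[measurable]: "y \<in> borel_measurable borel" and K: "energy y T b m \<le> ennreal K"
    let ?A = "\<lambda>k. {s. \<bar>y s - (- c)\<bar> \<le> (1 / 2) ^ k} \<inter> {0<..<T}"
    have A: "?A k \<in> sets lborel" for k by measurable
    have AA: "ennreal (a ^ Suc k) * emeasure lborel (?A k) \<le> ennreal (a ^ Suc k * (D / b ^ k))" for k
    proof -
      have "?A k \<in> fmeasurable lborel" by (rule bounded_Int_fmeasurable) measurable
      then have "emeasure lborel (?A k) = ennreal (measure lborel (?A k))"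
        by (rule emeasure_eq_measure2)
      also have "\<dots> \<le> ennreal (D / b ^ k)"
        unfolding D_def using a K
        by (intro ennreal_leI occupation_le_of_energy[OF y]) (auto simp: max_def ennreal_neg)
      finally show ?thesis
        using a by (subst ennreal_mult') (auto intro: mult_left_mono)
    qed
    have "(\<integral>\<^sup>+ s\<in>{0..T}. intensity lam \<alpha> (c + y s) \<partial>lborel) = (\<integral>\<^sup>+ s\<in>{0<..<T}. intensity lam \<alpha> (c + y s) \<partial>lborel)"
      by (rule nn_integral_cong_AE, rule AE_mp[OF AE_lborel_singleton[of 0]], rule AE_mp[OF AE_lborel_singleton[of T]])
        (auto simp: indicator_def)
    also have "\<dots> \<le> (\<integral>\<^sup>+ s. ennreal lam * (indicator {0<..<T} s + (\<Sum>k. ennreal (a ^ Suc k) * indicator (?A k) s)) \<partial>lborel)"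
    proof (rule nn_integral_mono)
      fix s
      show "intensity lam \<alpha> (c + y s) * indicator {0<..<T} s \<le> ennreal lam * (indicator {0<..<T} s + (\<Sum>k. ennreal (a ^ Suc k) * indicator (?A k) s))"
        using intensity_le_dyadic[OF \<alpha>, of lam "c + y s"]
        by (auto simp: indicator_def a_def add.commute)
    qed
    also have "\<dots> = ennreal lam * (emeasure lborel {0<..<T} + (\<Sum>k. ennreal (a ^ Suc k) * emeasure lborel (?A k)))"
      using A
      by (subst nn_integral_cmult, measurable)
        (subst nn_integral_add; simp add: nn_integral_suminf nn_integral_cmult_indicator del: power_Suc)
    also have "\<dots> \<le> ennreal lam * (ennreal (max 0 T) + (\<Sum>k. ennreal (a ^ Suc k * (D / b ^ k))))"
      by (intro mult_left_mono add_mono suminf_le AA) (auto simp: max_def)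
    also have "(\<Sum>k. ennreal (a ^ Suc k * (D / b ^ k))) = ennreal S"
      unfolding S_def using a D by (intro suminf_ennreal2 sm) auto
    also have "ennreal lam * (ennreal (max 0 T) + ennreal S) = ennreal (max 0 lam * (max 0 T + S))"
      using S by (simp add: ennreal_mult max_def ennreal_neg flip: ennreal_plus)
    finally show "(\<integral>\<^sup>+ s\<in>{0..T}. intensity lam \<alpha> (c + y s) \<partial>lborel) \<le> ennreal (max 0 lam * (max 0 T + S))" .
  qed
qed

text \<open>Here \<alpha> < 1 enters: it leaves room for \<open>b\<close> strictly between 2 powr
  \<alpha> and 2, and then b * (b / 2) ^ m < 1 for large \<open>m\<close>.\<close>

lemma exists_energy_exponent:
  fixes \<alpha> :: real
  assumes "\<alpha> < 1"
  obtains b :: real and m :: nat where "2 powr \<alpha> < b" "b ^ Suc m < 2 ^ m"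
proof -
  have "2 powr \<alpha> < (2::real) powr 1" using assms by (intro powr_less_mono) auto
  then obtain b :: real where b: "2 powr \<alpha> < b" "b < 2" using dense[of "2 powr \<alpha>" 2] by auto
  then have b0: "b > 0" by (rule_tac less_trans[of 0 "2 powr \<alpha>"]) auto
  obtain m where "(b / 2) ^ m < 1 / b"
    using real_arch_pow_inv[of "1 / b" "b / 2"] b b0 by auto
  then have "b ^ Suc m < 2 ^ m" using b0 by (simp add: power_divide field_simps)
  with b(1) show thesis by (rule that)
qed

section \<open>Interaction times\<close>

lemma exp_neg_bounds: "0 \<le> exp_neg h" "exp_neg h \<le> 1"
  by (simp_all add: exp_neg_def)

lemma exp_neg_ge:
  assumes "h \<le> ennreal B" "0 \<le> B"
  shows "exp (- B) \<le> exp_neg h"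
proof -
  have "h < \<infinity>" using assms(1) by (auto intro: le_less_trans)
  moreover have "enn2real h \<le> B"
    using assms by (intro enn2real_leI) auto
  ultimately show ?thesis by (auto simp: exp_neg_def)
qed

text \<open>The values of \<open>h\<close> are eventually finite, so the branch of
  \<open>exp_neg\<close> at infinity does not affect the limit.\<close>

lemma exp_neg_tendsto:
  assumes "h \<longlonglongrightarrow> 0"
  shows "(\<lambda>j. exp_neg (h j)) \<longlonglongrightarrow> 1"
proof -
  have "(\<lambda>j. enn2real (h j)) \<longlonglongrightarrow> 0"
    by (rule tendsto_enn2real) (use assms in auto)
  then have "(\<lambda>j. exp (- enn2real (h j))) \<longlonglongrightarrow> exp (- 0)"
    by (intro tendsto_exp tendsto_minus)
  moreover have "\<forall>\<^sub>F j in sequentially. h j < \<infinity>"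
    using assms by (rule order_tendstoD) simp
  then have "\<forall>\<^sub>F j in sequentially. exp (- enn2real (h j)) = exp_neg (h j)"
    by eventually_elim (auto simp: exp_neg_def)
  ultimately show ?thesis by (simp add: tendsto_cong)
qed

text \<open>This is continuity from above of the measure with density \<open>f\<close>: the
  intervals shrink to the null set {0}, and their measures are finite.\<close>

lemma nn_integral_shrinking_tendsto_0:
  fixes f :: "real \<Rightarrow> ennreal"
  assumes f[measurable]: "f \<in> borel_measurable borel" and fin: "(\<integral>\<^sup>+ s\<in>{0..1}. f s \<partial>lborel) < \<infinity>"
  shows "(\<lambda>j. \<integral>\<^sup>+ s\<in>{0..1 / real (Suc j)}. f s \<partial>lborel) \<longlonglongrightarrow> 0"
proof -
  let ?D = "density lborel f" and ?A = "\<lambda>j. {0..1 / real (Suc j)}"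
  have "decseq ?A"
    by (rule decseq_SucI) (auto intro: order_trans simp: frac_le)
  moreover have "emeasure ?D (?A j) \<noteq> \<infinity>" for j
  proof -
    have "emeasure ?D (?A j) \<le> emeasure ?D {0..1}"
      by (rule emeasure_mono) (auto intro: order_trans)
    then show ?thesis using fin by (auto simp: emeasure_density)
  qed
  ultimately have "(\<lambda>j. emeasure ?D (?A j)) \<longlonglongrightarrow> emeasure ?D (\<Inter>j. ?A j)"
    by (intro Lim_emeasure_decseq) auto
  moreover have "(\<Inter>j. ?A j) = {0}"
  proof -
    have "x \<le> 0" if "\<And>j. x \<le> 1 / real (Suc j)" for x
    proof (rule ccontr)
      assume "\<not> x \<le> 0"
      then obtain j where "1 / real (Suc j) < x" using nat_approx_posE[of x] by auto
      with that[of j] show False by simp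
    qed
    then show ?thesis by (auto intro!: antisym)
  qed
  moreover have "emeasure ?D {0} = 0"
    using AE_lborel_singleton[of 0]
    by (subst emeasure_density) (auto simp: nn_integral_0_iff_AE indicator_def)
  ultimately show ?thesis by (simp add: emeasure_density)
qed

lemma past_and_noise:
  assumes "standard_brownian_motion M W" and "\<And>n. \<gamma> n \<in> borel_measurable M"
  shows subalgebra_past_and_noise: "subalgebra M (past_and_noise M W \<gamma> n)"
    and past_and_noise_time: "k \<le> n \<Longrightarrow> \<gamma> k \<in> borel_measurable (past_and_noise M W \<gamma> n)"
    and past_and_noise_noise: "0 \<le> s \<Longrightarrow> W s \<in> borel_measurable (past_and_noise M W \<gamma> n)"
proof -
  let ?G = "{\<gamma> k -` A \<inter> space M | k A. k \<le> n \<and> A \<in> sets borel} \<union>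
      {W s -` A \<inter> space M | s A. 0 \<le> s \<and> A \<in> sets borel}"
  have W: "W s \<in> borel_measurable M" if "0 \<le> s" for s
    using assms(1) that by (simp add: standard_brownian_motion_def)
  have G: "?G \<subseteq> sets M"
    using measurable_sets[OF assms(2)] measurable_sets[OF W] by blast
  then have Gp: "?G \<subseteq> Pow (space M)" using sets.space_closed by blast
  have sp: "space (past_and_noise M W \<gamma> n) = space M"
    unfolding past_and_noise_def by (rule space_measure_of[OF Gp])
  have st: "sets (past_and_noise M W \<gamma> n) = sigma_sets (space M) ?G"
    unfolding past_and_noise_def by (rule sets_measure_of[OF Gp])
  show "subalgebra M (past_and_noise M W \<gamma> n)"
    unfolding subalgebra_def sp st using sets.sigma_sets_subset[OF G] by blast
  show "\<gamma> k \<in> borel_measurable (past_and_noise M W \<gamma> n)" if "k \<le> n"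
    by (rule measurableI) (use that in \<open>auto simp: sp st intro!: sigma_sets.Basic\<close>)
  show "W s \<in> borel_measurable (past_and_noise M W \<gamma> n)" if "0 \<le> s"
    by (rule measurableI) (use that in \<open>auto simp: sp st intro!: sigma_sets.Basic\<close>)
qed

section \<open>The jump model and its tame events\<close>

locale jump_model =
  fixes M :: "'a measure" and W :: "real \<Rightarrow> 'a \<Rightarrow> real" and \<gamma> :: "nat \<Rightarrow> 'a \<Rightarrow> ereal"
    and lam \<alpha> \<mu> \<sigma> \<theta> x0 :: real
  assumes \<sigma>: "\<sigma> > 0" and \<alpha>: "0 \<le> \<alpha>" "\<alpha> < 1"
    and bm: "standard_brownian_motion M W"
    and times: "interaction_times M W lam \<alpha> \<mu> \<sigma> \<theta> x0 \<gamma>"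
begin

sublocale prob_space M using bm by (simp add: standard_brownian_motion_def)

abbreviation past :: "nat \<Rightarrow> 'a measure" where "past \<equiv> past_and_noise M W \<gamma>"

abbreviation survival :: "nat \<Rightarrow> real \<Rightarrow> 'a \<Rightarrow> real" where
  "survival n t \<omega> \<equiv> exp_neg (cumulative_intensity lam \<alpha> \<mu> \<sigma> \<theta> x0 (\<lambda>s. W s \<omega>) (\<lambda>k. \<gamma> k \<omega>) n t)"

lemma W_measurable: "0 \<le> t \<Longrightarrow> W t \<in> borel_measurable M"
  and W_continuous: "\<omega> \<in> space M \<Longrightarrow> continuous_on {0..} (\<lambda>t. W t \<omega>)"
  using bm by (auto simp: standard_brownian_motion_def)

lemma \<gamma>_measurable: "\<gamma> n \<in> borel_measurable M"
  using times by (simp add: interaction_times_def)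

lemma \<gamma>_0: "\<omega> \<in> space M \<Longrightarrow> \<gamma> 0 \<omega> = 0"
  and \<gamma>_Suc: "\<omega> \<in> space M \<Longrightarrow> \<gamma> n \<omega> \<le> \<gamma> (Suc n) \<omega>"
  using times by (auto simp: interaction_times_def)

lemma \<gamma>_nonneg: "\<omega> \<in> space M \<Longrightarrow> 0 \<le> \<gamma> n \<omega>"
proof (induction n)
  case (Suc n)
  then show ?case using \<gamma>_Suc[of \<omega> n] by (auto intro: order_trans)
qed (simp add: \<gamma>_0)

lemma subalgebra_past: "subalgebra M (past n)"
  by (rule subalgebra_past_and_noise[where \<gamma>=\<gamma>, OF bm \<gamma>_measurable])

lemma space_past: "space (past n) = space M"
  using subalgebra_past by (simp add: subalgebra_def)

lemma path_measurable:
  "\<omega> \<in> space M \<Longrightarrow> (\<lambda>s. drifted \<mu> \<sigma> W s \<omega>) \<in> borel_measurable borel"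
  using measurable_compose[OF measurable_Pair1' drifted_jointly_measurable[OF W_measurable W_continuous]]
  by fastforce

text \<open>The jump history is confined to an additive constant, so a bound uniform over translates
  of the drifted path applies to every gap.\<close>

lemma free_flow_eq_drifted:
  assumes "0 \<le> a" "0 \<le> s"
  shows "free_flow \<mu> \<sigma> (\<lambda>s. W s \<omega>) a z s = (z - drifted \<mu> \<sigma> W a \<omega>) + drifted \<mu> \<sigma> W (a + s) \<omega>"
  using assms by (simp add: free_flow_def drifted_def algebra_simps)

text \<open>The horizon is \<open>2 * T\<close> because a gap of length \<open>T\<close> may start at any time up to \<open>T\<close>.\<close>

definition tame :: "real \<Rightarrow> nat \<Rightarrow> real \<Rightarrow> real \<Rightarrow> nat \<Rightarrow> 'a set" where
  "tame b m T K n = {\<omega>\<in>space M. energy (\<lambda>s. drifted \<mu> \<sigma> W s \<omega>) (2 * T) b m \<le> ennreal K \<and> \<gamma> n \<omega> \<le> ereal T}"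

text \<open>The state at \<open>\<gamma> n\<close> enters only as a translation, and a start at a
  \<le> T keeps the window [a, a + T] inside [0, 2 * T]. Hence one \<open>B\<close> serves all
  \<open>n\<close> and all tame outcomes.\<close>

lemma cumulative_intensity_bounded:
  assumes "2 powr \<alpha> < b"
  shows "\<exists>B\<ge>0. \<forall>n. \<forall>\<omega>\<in>tame b m T K n.
    cumulative_intensity lam \<alpha> \<mu> \<sigma> \<theta> x0 (\<lambda>s. W s \<omega>) (\<lambda>k. \<gamma> k \<omega>) n T \<le> ennreal B"
proof -
  obtain B where B: "B \<ge> 0" "\<And>y c. y \<in> borel_measurable borel \<Longrightarrow> energy y (2 * T) b m \<le> ennreal K \<Longrightarrow>
    (\<integral>\<^sup>+ s\<in>{0..2 * T}. intensity lam \<alpha> (c + y s) \<partial>lborel) \<le> ennreal B"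
    using potential_bounded_of_energy[OF \<alpha>(1) assms, of "2 * T" m K lam] by metis
  show ?thesis
  proof (intro exI[of _ B] conjI allI ballI)
    fix n \<omega> assume "\<omega> \<in> tame b m T K n"
    then have \<omega>: "\<omega> \<in> space M" and K: "energy (\<lambda>s. drifted \<mu> \<sigma> W s \<omega>) (2 * T) b m \<le> ennreal K"
      and "\<gamma> n \<omega> \<le> ereal T"
      by (simp_all add: tame_def)
    with \<gamma>_nonneg[OF \<omega>, of n] obtain a where a: "\<gamma> n \<omega> = ereal a" "0 \<le> a" "a \<le> T"
      by (cases "\<gamma> n \<omega>") auto
    note [measurable] = path_measurable[OF \<omega>]
    define c where "c = state_at \<mu> \<sigma> \<theta> x0 (\<lambda>s. W s \<omega>) (\<lambda>k. \<gamma> k \<omega>) n - drifted \<mu> \<sigma> W a \<omega>"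
    have [measurable]: "intensity lam \<alpha> \<in> borel_measurable borel"
      unfolding intensity_def by measurable
    have "cumulative_intensity lam \<alpha> \<mu> \<sigma> \<theta> x0 (\<lambda>s. W s \<omega>) (\<lambda>k. \<gamma> k \<omega>) n T
      = (\<integral>\<^sup>+ s. intensity lam \<alpha> (c + drifted \<mu> \<sigma> W (a + 1 * s) \<omega>) * indicator {a..a + T} (a + 1 * s) \<partial>lborel)"
      unfolding cumulative_intensity_def
      using a by (intro nn_integral_cong) (auto simp: indicator_def free_flow_eq_drifted c_def)
    also have "\<dots> = (\<integral>\<^sup>+ s. intensity lam \<alpha> (c + drifted \<mu> \<sigma> W s \<omega>) * indicator {a..a + T} s \<partial>lborel)"
      by (subst nn_integral_real_affine[where c=1 and t=a]) auto
    also have "\<dots> \<le> (\<integral>\<^sup>+ s\<in>{0..2 * T}. intensity lam \<alpha> (c + drifted \<mu> \<sigma> W s \<omega>) \<partial>lborel)"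
      using a by (intro nn_integral_mono) (auto simp: indicator_def)
    also have "\<dots> \<le> ennreal B" by (rule B(2)[OF path_measurable[OF \<omega>] K])
    finally show "cumulative_intensity lam \<alpha> \<mu> \<sigma> \<theta> x0 (\<lambda>s. W s \<omega>) (\<lambda>k. \<gamma> k \<omega>) n T \<le> ennreal B" .
  qed (rule B(1))
qed

section \<open>Integrating the conditional law of the gaps\<close>

lemma gap_event: "{\<omega>\<in>space M. \<gamma> n \<omega> + ereal t < \<gamma> (Suc n) \<omega>} \<in> events"
proof -
  have "(\<lambda>\<omega>. \<gamma> n \<omega> + ereal t) \<in> borel_measurable M"
    by (intro borel_measurable_ereal_add \<gamma>_measurable borel_measurable_const)
  from borel_measurable_less[OF this \<gamma>_measurable] show ?thesis .
qed

lemma jump_event: "{\<omega>\<in>space M. \<gamma> n \<omega> < \<gamma> (Suc n) \<omega>} \<in> events"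
  by (rule borel_measurable_less[OF \<gamma>_measurable \<gamma>_measurable])

text \<open>This is the defining property of conditional expectation over an event of the past. The
  version \<open>R\<close> stands in for \<open>survival\<close> in the integral because it is
  measurable by construction.\<close>

lemma conditional_survival:
  assumes E: "E \<in> sets (past n)" and fin: "\<And>\<omega>. \<omega> \<in> E \<Longrightarrow> \<gamma> n \<omega> < \<infinity>" and t: "t > 0"
  obtains R where "R \<in> borel_measurable M" "integrable M R"
    "AE \<omega> in M. \<omega> \<in> E \<longrightarrow> R \<omega> = survival n t \<omega>"
    "prob (E \<inter> {\<omega>\<in>space M. \<gamma> n \<omega> + ereal t < \<gamma> (Suc n) \<omega>}) = (\<integral>\<omega>. indicator E \<omega> * R \<omega> \<partial>M)"
proof -
  let ?S = "{\<omega>\<in>space M. \<gamma> n \<omega> + ereal t < \<gamma> (Suc n) \<omega>}"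
  let ?R = "real_cond_exp M (past n) (indicator ?S)"
  interpret F: finite_measure_subalgebra M "past n"
    by unfold_locales (rule subalgebra_past)
  have EM: "E \<in> sets M" using E subalgebra_past[of n] by (auto simp: subalgebra_def)
  have S: "?S \<in> sets M" by (rule gap_event)
  have int: "integrable M (indicator ?S :: 'a \<Rightarrow> real)"
    using S by (simp add: integrable_indicator_iff emeasure_eq_measure)
  show thesis
  proof (rule that[of ?R])
    show "?R \<in> borel_measurable M" by (rule borel_measurable_cond_exp2)
    show "integrable M ?R" by (rule F.real_cond_exp_int(1)[OF int])
    have "AE \<omega> in M. \<gamma> n \<omega> < \<infinity> \<longrightarrow> ?R \<omega> = survival n t \<omega>"
      using times t by (auto simp: interaction_times_def)
    then show "AE \<omega> in M. \<omega> \<in> E \<longrightarrow> ?R \<omega> = survival n t \<omega>"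
      by eventually_elim (use fin in auto)
    have "prob (E \<inter> ?S) = (\<integral>\<omega>. indicator E \<omega> * indicator ?S \<omega> \<partial>M)"
      using EM S by (simp flip: indicator_inter_arith)
    also have "\<dots> = (\<integral>\<omega>. indicator E \<omega> * ?R \<omega> \<partial>M)"
      using F.real_cond_exp_intA[OF int E] by (simp add: set_lebesgue_integral_def)
    finally show "prob (E \<inter> ?S) = (\<integral>\<omega>. indicator E \<omega> * ?R \<omega> \<partial>M)" .
  qed
qed

text \<open>The energy is a function of the noise and \<open>\<gamma> n\<close> belongs to the past,
  so the conditional law of the next gap may be integrated over this event.\<close>

lemma tame_past: "tame b m T K n \<in> sets (past n)"
proof -
  have [measurable]: "(\<lambda>\<omega>. energy (\<lambda>s. drifted \<mu> \<sigma> W s \<omega>) (2 * T) b m) \<in> borel_measurable (past n)"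
    by (rule energy_measurable[OF past_and_noise_noise[where \<gamma>=\<gamma>, OF bm \<gamma>_measurable]])
      (auto simp: space_past W_continuous)
  have [measurable]: "\<gamma> n \<in> borel_measurable (past n)"
    by (rule past_and_noise_time[where \<gamma>=\<gamma>, OF bm \<gamma>_measurable]) simp
  have "{\<omega>\<in>space (past n). energy (\<lambda>s. drifted \<mu> \<sigma> W s \<omega>) (2 * T) b m \<le> ennreal K \<and> \<gamma> n \<omega> \<le> ereal T} \<in> sets (past n)"
    by measurable
  then show ?thesis by (simp add: tame_def space_past)
qed

lemma tame_events: "tame b m T K n \<in> events"
  using tame_past[of b m T K n] subalgebra_past[of n] by (auto simp: subalgebra_def)

text \<open>Fixing the energy bound \<open>K\<close> takes the place of conditioning on
  \<open>W\<close>: on every tame event the next gap exceeds \<open>T\<close> with conditional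
  probability at least one constant \<open>p\<close>. Such a gap leaves the decreasing sequence of
  tame events for good, so their probabilities decay geometrically.\<close>

lemma AE_leaves_tame:
  assumes T: "T > 0" and b: "2 powr \<alpha> < b"
  shows "AE \<omega> in M. \<exists>n. \<omega> \<notin> tame b m T K n"
proof -
  let ?E = "tame b m T K"
  obtain B where B: "B \<ge> 0"
    "\<And>n \<omega>. \<omega> \<in> ?E n \<Longrightarrow> cumulative_intensity lam \<alpha> \<mu> \<sigma> \<theta> x0 (\<lambda>s. W s \<omega>) (\<lambda>k. \<gamma> k \<omega>) n T \<le> ennreal B"
    using cumulative_intensity_bounded[OF b] by blast
  define p where "p = exp (- B)"
  have p: "0 < p" "p \<le> 1" using B(1) by (auto simp: p_def)
  have step: "prob (?E (Suc n)) \<le> (1 - p) * prob (?E n)" for n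
  proof -
    let ?S = "{\<omega>\<in>space M. \<gamma> n \<omega> + ereal T < \<gamma> (Suc n) \<omega>}"
    have fin: "\<gamma> n \<omega> < \<infinity>" if "\<omega> \<in> ?E n" for \<omega> using that by (auto simp: tame_def)
    obtain R where R: "R \<in> borel_measurable M" "integrable M R"
      "AE \<omega> in M. \<omega> \<in> ?E n \<longrightarrow> R \<omega> = survival n T \<omega>"
      "prob (?E n \<inter> ?S) = (\<integral>\<omega>. indicator (?E n) \<omega> * R \<omega> \<partial>M)"
      by (rule conditional_survival[OF tame_past fin T])
    have "p * prob (?E n) = (\<integral>\<omega>. p * indicator (?E n) \<omega> \<partial>M)"
      using tame_events[of b m T K n] by (simp add: sets.Int_space_eq2)
    also have "\<dots> \<le> (\<integral>\<omega>. indicator (?E n) \<omega> * R \<omega> \<partial>M)"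
    proof (rule integral_mono_AE)
      show "integrable M (\<lambda>\<omega>. p * indicator (?E n) \<omega>)"
        using tame_events[of b m T K n] by (simp add: emeasure_eq_measure)
      show "integrable M (\<lambda>\<omega>. indicator (?E n) \<omega> * R \<omega>)"
        by (rule integrable_real_mult_indicator[OF tame_events R(2), THEN Bochner_Integration.integrable_cong[THEN iffD1, rotated 2]])
          (auto simp: mult.commute)
      show "AE \<omega> in M. p * indicator (?E n) \<omega> \<le> indicator (?E n) \<omega> * R \<omega>"
        using R(3)
      proof eventually_elim
        case (elim \<omega>)
        then show ?case
          using exp_neg_ge[OF B(2) B(1), of \<omega> n] by (cases "\<omega> \<in> ?E n") (simp_all add: p_def)
      qed
    qed
    finally have "p * prob (?E n) \<le> prob (?E n \<inter> ?S)" using R(4) by simp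
    moreover have "prob (?E (Suc n)) + prob (?E n \<inter> ?S) \<le> prob (?E n)"
    proof -
      have S: "?S \<in> events" by (rule gap_event)
      have sub: "?E (Suc n) \<subseteq> ?E n"
        using \<gamma>_Suc by (auto simp: tame_def intro: order_trans)
      \<comment> \<open>Since \<open>\<gamma> n\<close> is nonnegative, a gap longer than
        \<open>T\<close> puts \<open>\<gamma> (Suc n)\<close> beyond \<open>T\<close>.\<close>
      have disj: "?E (Suc n) \<inter> (?E n \<inter> ?S) = {}"
      proof safe
        fix \<omega> assume "\<omega> \<in> ?E (Suc n)" "\<gamma> n \<omega> + ereal T < \<gamma> (Suc n) \<omega>"
        moreover from this have "\<omega> \<in> space M" by (simp add: tame_def)
        moreover have "ereal T \<le> \<gamma> n \<omega> + ereal T"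
          using \<gamma>_nonneg[OF \<open>\<omega> \<in> space M\<close>, of n] by (cases "\<gamma> n \<omega>") auto
        ultimately show "\<omega> \<in> {}" by (auto simp: tame_def)
      qed
      have "prob (?E (Suc n)) + prob (?E n \<inter> ?S) = prob (?E (Suc n) \<union> (?E n \<inter> ?S))"
        using disj S tame_events by (intro finite_measure_Union[symmetric]) auto
      also have "\<dots> \<le> prob (?E n)"
        using sub tame_events by (intro finite_measure_mono) auto
      finally show ?thesis .
    qed
    ultimately show ?thesis by (simp add: algebra_simps)
  qed
  have pow: "prob (?E n) \<le> (1 - p) ^ n" for n
  proof (induction n)
    case (Suc n)
    have "prob (?E (Suc n)) \<le> (1 - p) * prob (?E n)" by (rule step)
    also have "\<dots> \<le> (1 - p) * (1 - p) ^ n"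
      using p Suc by (intro mult_left_mono) auto
    finally show ?case by simp
  qed simp
  have I: "(\<Inter>n. ?E n) \<in> events" using tame_events by auto
  have "prob (\<Inter>n. ?E n) \<le> 0"
  proof (rule LIMSEQ_le_const)
    show "(\<lambda>n. (1 - p) ^ n) \<longlonglongrightarrow> 0" using p by (intro LIMSEQ_power_zero) auto
    have "prob (\<Inter>n. ?E n) \<le> (1 - p) ^ n" for n
      using finite_measure_mono[of "\<Inter>n. ?E n" "?E n"] tame_events pow[of n] by (auto intro: order_trans)
    then show "\<exists>N. \<forall>n\<ge>N. prob (\<Inter>n. ?E n) \<le> (1 - p) ^ n" by blast
  qed
  then have "prob (\<Inter>n. ?E n) = 0" by (simp add: measure_le_0_iff)
  then have "(\<Inter>n. ?E n) \<in> null_sets M" using I by (simp add: emeasure_eq_measure null_setsI)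
  then have "AE \<omega> in M. \<omega> \<notin> (\<Inter>n. ?E n)" by (rule AE_not_in)
  then show ?thesis by eventually_elim auto
qed

text \<open>The law is prescribed for t > 0 only, so strictness is obtained as a limit. The
  cumulative intensity up to 1 / (j + 1) tends to 0, hence the gaps longer than 1 / (j + 1) exhaust
  the tame event in probability. T \<ge> 1 brings the interval [0, 1] under the available
  bound.\<close>

lemma AE_strict_on_tame:
  assumes T: "T \<ge> 1" and b: "2 powr \<alpha> < b"
  shows "AE \<omega> in M. \<omega> \<in> tame b m T K n \<longrightarrow> \<gamma> n \<omega> < \<gamma> (Suc n) \<omega>"
proof -
  let ?E = "tame b m T K n"
  let ?cum = "\<lambda>\<omega>. cumulative_intensity lam \<alpha> \<mu> \<sigma> \<theta> x0 (\<lambda>s. W s \<omega>) (\<lambda>k. \<gamma> k \<omega>) n"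
  let ?S = "\<lambda>j. {\<omega>\<in>space M. \<gamma> n \<omega> + ereal (1 / real (Suc j)) < \<gamma> (Suc n) \<omega>}"
  let ?J = "{\<omega>\<in>space M. \<gamma> n \<omega> < \<gamma> (Suc n) \<omega>}"
  obtain B where B: "B \<ge> 0"
    "\<And>n \<omega>. \<omega> \<in> tame b m T K n \<Longrightarrow> cumulative_intensity lam \<alpha> \<mu> \<sigma> \<theta> x0 (\<lambda>s. W s \<omega>) (\<lambda>k. \<gamma> k \<omega>) n T \<le> ennreal B"
    using cumulative_intensity_bounded[OF b] by blast
  have lim: "(\<lambda>j. survival n (1 / real (Suc j)) \<omega>) \<longlonglongrightarrow> 1" if \<omega>: "\<omega> \<in> ?E" for \<omega>
  proof (rule exp_neg_tendsto)
    have sp: "\<omega> \<in> space M" using \<omega> by (simp add: tame_def)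
    note [measurable] = path_measurable[OF sp]
    define a where "a = real_of_ereal (\<gamma> n \<omega>)"
    have a: "0 \<le> a" using \<gamma>_nonneg[OF sp, of n] by (simp add: a_def real_of_ereal_pos)
    define c where "c = state_at \<mu> \<sigma> \<theta> x0 (\<lambda>s. W s \<omega>) (\<lambda>k. \<gamma> k \<omega>) n - drifted \<mu> \<sigma> W a \<omega>"
    have [measurable]: "intensity lam \<alpha> \<in> borel_measurable borel"
      unfolding intensity_def by measurable
    have eq: "?cum \<omega> t = (\<integral>\<^sup>+ s\<in>{0..t}. intensity lam \<alpha> (c + drifted \<mu> \<sigma> W (a + s) \<omega>) \<partial>lborel)" for t
      unfolding cumulative_intensity_def
      using a by (intro nn_integral_cong) (auto simp: indicator_def free_flow_eq_drifted c_def a_def)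
    have "?cum \<omega> 1 \<le> ?cum \<omega> T"
      unfolding eq using T by (intro nn_integral_mono) (auto simp: indicator_def)
    also have "\<dots> \<le> ennreal B" by (rule B(2)[OF \<omega>])
    finally have "?cum \<omega> 1 < \<infinity>" by (auto intro: le_less_trans)
    then show "(\<lambda>j. ?cum \<omega> (1 / real (Suc j))) \<longlonglongrightarrow> 0"
      unfolding eq by (intro nn_integral_shrinking_tendsto_0) auto
  qed
  have fin: "\<gamma> n \<omega> < \<infinity>" if "\<omega> \<in> ?E" for \<omega> using that by (auto simp: tame_def)
  \<comment> \<open>One version is chosen for each \<open>j\<close>; being countably many, they
    agree with the survival probabilities on the tame event outside a single null set.\<close>
  have "\<exists>R. \<forall>j. R j \<in> borel_measurable M \<and>
      (AE \<omega> in M. \<omega> \<in> ?E \<longrightarrow> R j \<omega> = survival n (1 / real (Suc j)) \<omega>) \<and>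
      prob (?E \<inter> ?S j) = (\<integral>\<omega>. indicator ?E \<omega> * R j \<omega> \<partial>M)"
  proof (rule choice, rule allI)
    fix j :: nat
    have t: "1 / real (Suc j) > 0" by simp
    obtain R where "R \<in> borel_measurable M" "integrable M R"
      "AE \<omega> in M. \<omega> \<in> ?E \<longrightarrow> R \<omega> = survival n (1 / real (Suc j)) \<omega>"
      "prob (?E \<inter> ?S j) = (\<integral>\<omega>. indicator ?E \<omega> * R \<omega> \<partial>M)"
      by (rule conditional_survival[OF tame_past fin t])
    then show "\<exists>R. R \<in> borel_measurable M \<and>
      (AE \<omega> in M. \<omega> \<in> ?E \<longrightarrow> R \<omega> = survival n (1 / real (Suc j)) \<omega>) \<and>
      prob (?E \<inter> ?S j) = (\<integral>\<omega>. indicator ?E \<omega> * R \<omega> \<partial>M)"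
      by (intro exI[of _ R] conjI)
  qed
  then obtain R where "\<forall>j. R j \<in> borel_measurable M \<and>
      (AE \<omega> in M. \<omega> \<in> ?E \<longrightarrow> R j \<omega> = survival n (1 / real (Suc j)) \<omega>) \<and>
      prob (?E \<inter> ?S j) = (\<integral>\<omega>. indicator ?E \<omega> * R j \<omega> \<partial>M)" ..
  then have R: "\<And>j. R j \<in> borel_measurable M"
      "\<And>j. AE \<omega> in M. \<omega> \<in> ?E \<longrightarrow> R j \<omega> = survival n (1 / real (Suc j)) \<omega>"
      "\<And>j. prob (?E \<inter> ?S j) = (\<integral>\<omega>. indicator ?E \<omega> * R j \<omega> \<partial>M)"
    by iprover+
  have "(\<lambda>j. \<integral>\<omega>. indicator ?E \<omega> * R j \<omega> \<partial>M) \<longlonglongrightarrow> (\<integral>\<omega>. indicator ?E \<omega> \<partial>M)"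
  proof (rule integral_dominated_convergence[where w="\<lambda>_. 1"])
    show "indicator ?E \<in> borel_measurable M" using tame_events by simp
    show "(\<lambda>\<omega>. indicator ?E \<omega> * R j \<omega>) \<in> borel_measurable M" for j
      using tame_events R(1) by (intro borel_measurable_times) auto
    have ae: "AE \<omega> in M. \<forall>j. \<omega> \<in> ?E \<longrightarrow> R j \<omega> = survival n (1 / real (Suc j)) \<omega>"
      unfolding AE_all_countable by (intro allI R(2))
    then show "AE \<omega> in M. (\<lambda>j. indicator ?E \<omega> * R j \<omega>) \<longlonglongrightarrow> indicator ?E \<omega>"
    proof eventually_elim
      case (elim \<omega>)
      then show ?case using lim[of \<omega>] by (cases "\<omega> \<in> ?E") simp_all
    qed
    show "AE \<omega> in M. norm (indicator ?E \<omega> * R j \<omega>) \<le> 1" for j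
      using ae by eventually_elim (auto simp: indicator_def exp_neg_bounds)
  qed simp
  moreover have "(\<integral>\<omega>. indicator ?E \<omega> \<partial>M) = prob ?E"
    using tame_events[of b m T K n] by (simp add: sets.Int_space_eq2)
  ultimately have "(\<lambda>j. prob (?E \<inter> ?S j)) \<longlonglongrightarrow> prob ?E" using R(3) by simp
  moreover have "prob (?E \<inter> ?S j) \<le> prob (?E \<inter> ?J)" for j
  proof (rule finite_measure_mono)
    have "\<gamma> n \<omega> \<le> \<gamma> n \<omega> + ereal (1 / real (Suc j))" for \<omega>
      by (cases "\<gamma> n \<omega>") auto
    then show "?E \<inter> ?S j \<subseteq> ?E \<inter> ?J" by (auto intro: le_less_trans)
    show "?E \<inter> ?J \<in> events" by (intro sets.Int tame_events jump_event)
  qed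
  ultimately have ge: "prob ?E \<le> prob (?E \<inter> ?J)"
    by (intro LIMSEQ_le_const2[of _ "prob ?E"]) auto
  have J: "?E \<inter> ?J \<in> events" by (intro sets.Int tame_events jump_event)
  have "prob (?E - ?E \<inter> ?J) = prob ?E - prob (?E \<inter> ?J)"
    using tame_events J by (intro finite_measure_Diff) auto
  with ge have "prob (?E - ?E \<inter> ?J) = 0"
    using measure_nonneg[of M "?E - ?E \<inter> ?J"] by linarith
  then have "?E - ?E \<inter> ?J \<in> null_sets M"
    using tame_events J by (intro null_setsI) (auto simp: emeasure_eq_measure)
  from AE_not_in[OF this] show ?thesis
    by eventually_elim (auto simp: tame_def)
qed

text \<open>Integer horizons and integer energy bounds leave only countably many null sets to be
  discarded; the rest is an argument for one fixed outcome.\<close>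

lemma AE_no_accumulation:
  "AE \<omega> in M. (\<forall>n. \<gamma> n \<omega> < \<infinity> \<longrightarrow> \<gamma> n \<omega> < \<gamma> (Suc n) \<omega>) \<and> (\<lambda>n. \<gamma> n \<omega>) \<longlonglongrightarrow> \<infinity>"
proof -
  obtain b m where b: "2 powr \<alpha> < b" "b ^ Suc m < 2 ^ m"
    using exists_energy_exponent[OF \<alpha>(2)] by metis
  have b0: "b > 0" using b(1) by (rule less_trans[rotated]) simp
  have 1: "AE \<omega> in M. \<forall>i. energy (\<lambda>s. drifted \<mu> \<sigma> W s \<omega>) (2 * real (Suc i)) b m < \<infinity>"
    unfolding AE_all_countable using AE_energy_finite[OF bm \<sigma> _ b0 b(2)] by (simp del: of_nat_Suc)
  have 2: "AE \<omega> in M. \<forall>i K. \<exists>n. \<omega> \<notin> tame b m (real (Suc i)) (real K) n"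
    unfolding AE_all_countable using AE_leaves_tame[OF _ b(1)] by (simp del: of_nat_Suc)
  have 3: "AE \<omega> in M. \<forall>i K n. \<omega> \<in> tame b m (real (Suc i)) (real K) n \<longrightarrow> \<gamma> n \<omega> < \<gamma> (Suc n) \<omega>"
    unfolding AE_all_countable using AE_strict_on_tame[OF _ b(1)] by simp
  from 1 2 3 AE_space show ?thesis
  proof eventually_elim
    case (elim \<omega>)
    \<comment> \<open>With \<open>K\<close> above the energy of the path, the outcome can leave the
      tame events only by \<open>\<gamma> n\<close> exceeding the horizon i + 1.\<close>
    have tame: "\<exists>K. \<forall>n. \<gamma> n \<omega> \<le> ereal (real (Suc i)) \<longrightarrow> \<omega> \<in> tame b m (real (Suc i)) (real K) n" for i
    proof -
      obtain K where "energy (\<lambda>s. drifted \<mu> \<sigma> W s \<omega>) (2 * real (Suc i)) b m < of_nat K"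
        using elim(1) ennreal_Ex_less_of_nat by (auto simp del: of_nat_Suc)
      then show ?thesis
        using elim(4) by (intro exI[of _ K]) (auto simp: tame_def ennreal_of_nat_eq_real_of_nat simp del: of_nat_Suc)
    qed
    have "\<gamma> n \<omega> < \<gamma> (Suc n) \<omega>" if fin: "\<gamma> n \<omega> < \<infinity>" for n
    proof -
      obtain i where "\<gamma> n \<omega> \<le> ereal (real (Suc i))"
      proof -
        obtain a where "\<gamma> n \<omega> = ereal a" using fin \<gamma>_nonneg[OF elim(4), of n] by (cases "\<gamma> n \<omega>") auto
        moreover obtain i where "a \<le> real i" using real_arch_simple by blast
        ultimately show thesis by (intro that[of i]) auto
      qed
      with tame[of i] elim(3) show ?thesis by blast
    qed
    moreover have "(\<lambda>n. \<gamma> n \<omega>) \<longlonglongrightarrow> \<infinity>"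
    proof -
      have mono: "incseq (\<lambda>n. \<gamma> n \<omega>)" by (rule incseq_SucI) (rule \<gamma>_Suc[OF elim(4)])
      have "\<exists>n. ereal r < \<gamma> n \<omega>" for r
      proof -
        obtain i where i: "r \<le> real i" using real_arch_simple by blast
        obtain K where "\<And>n. \<gamma> n \<omega> \<le> ereal (real (Suc i)) \<Longrightarrow> \<omega> \<in> tame b m (real (Suc i)) (real K) n"
          using tame by blast
        with elim(2) obtain n where "\<not> \<gamma> n \<omega> \<le> ereal (real (Suc i))" by blast
        then have "ereal (real (Suc i)) < \<gamma> n \<omega>" by simp
        moreover have "ereal r \<le> ereal (real (Suc i))" using i by simp
        ultimately show ?thesis using le_less_trans by blast
      qed
      then show ?thesis
        unfolding tendsto_PInfty eventually_sequentially
        using mono by (meson incseqD less_le_trans)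
    qed
    ultimately show ?case by blast
  qed
qed

end

section \<open>The solution along a path\<close>

text \<open>Dividing the left limit \<open>l n\<close> by \<theta> is the same as subtracting
  \<open>l n / \<theta>'\<close>, so the states telescope into the jump sum. Divergence of
  \<open>g\<close> places every t \<ge> 0 in one of the intervals between interactions.\<close>

lemma jump_process_solves_jump_sde:
  fixes w :: "real \<Rightarrow> real" and g :: "nat \<Rightarrow> ereal"
  assumes w: "continuous_on {0..} w" "w 0 = 0"
    and g0: "g 0 = 0" and strict: "\<And>n. g n < \<infinity> \<Longrightarrow> g n < g (Suc n)" and mono: "incseq g"
    and lim: "g \<longlonglongrightarrow> \<infinity>"
    and \<theta>: "\<theta> \<noteq> 0" "1 / \<theta> + 1 / \<theta>' = 1"
  shows "\<exists>x. (\<forall>t\<ge>0. jump_process \<mu> \<sigma> \<theta> x0 w g t = Some (x t)) \<and> solves_jump_sde \<mu> \<sigma> \<theta>' x0 w g x"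
proof -
  define a where "a n = real_of_ereal (g n)" for n
  define s where "s = state_at \<mu> \<sigma> \<theta> x0 w g"
  define x where "x t = the (jump_process \<mu> \<sigma> \<theta> x0 w g t)" for t
  define l where "l n = free_flow \<mu> \<sigma> w (a n) (s n) (a (Suc n) - a n)" for n
  have nonneg: "0 \<le> g n" for n using incseqD[OF mono, of 0 n] g0 by simp
  have a0: "0 \<le> a n" for n using nonneg[of n] by (simp add: a_def real_of_ereal_pos)
  have a: "g n = ereal (a n)" if "g n < \<infinity>" for n
    using that nonneg[of n] by (cases "g n") (auto simp: a_def)
  have fin: "g k < \<infinity>" if "g n \<le> ereal t" "k \<le> n" for n k t
    using incseqD[OF mono that(2)] that(1) by (auto intro: le_less_trans)
  have x_eq: "jump_process \<mu> \<sigma> \<theta> x0 w g t = Some (free_flow \<mu> \<sigma> w (a n) (s n) (t - a n))"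
    if n: "g n \<le> ereal t" "ereal t < g (Suc n)" for n t
  proof -
    have "(THE n. g n \<le> ereal t \<and> ereal t < g (Suc n)) = n"
    proof (rule the_equality)
      fix k assume k: "g k \<le> ereal t \<and> ereal t < g (Suc k)"
      show "k = n"
      proof (rule ccontr)
        assume "k \<noteq> n"
        then have "Suc k \<le> n \<or> Suc n \<le> k" by auto
        then have "g (Suc k) \<le> g n \<or> g (Suc n) \<le> g k" using mono by (auto dest: incseqD)
        with k n show False by (meson leD le_less_trans less_le_trans)
      qed
    qed (use n in simp)
    then show ?thesis using n unfolding jump_process_def a_def s_def by (auto simp: Let_def)
  qed
  have ex: "\<exists>n. g n \<le> ereal t \<and> ereal t < g (Suc n)" if "0 \<le> t" for t
  proof -
    have "\<exists>n. ereal t < g n" using lim by (auto simp: tendsto_PInfty eventually_sequentially)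
    define N where "N = (LEAST n. ereal t < g n)"
    have N: "ereal t < g N" unfolding N_def using \<open>\<exists>n. ereal t < g n\<close> by (rule LeastI_ex)
    moreover have "N \<noteq> 0" using N g0 that by (intro notI) simp
    then obtain n where n: "N = Suc n" by (cases N) auto
    moreover have "\<not> ereal t < g n" using not_less_Least[of n "\<lambda>n. ereal t < g n"] n N_def by simp
    ultimately show ?thesis by (intro exI[of _ n]) simp
  qed
  have xt: "jump_process \<mu> \<sigma> \<theta> x0 w g t = Some (x t)" if "0 \<le> t" for t
    using ex[OF that] x_eq by (auto simp: x_def)
  have state: "s n = x0 + \<mu> * a n + \<sigma> * w (a n) - (\<Sum>i<n. l i / \<theta>')" if "g n < \<infinity>" for n
    using that
  proof (induction n)
    case 0
    then show ?case by (simp add: s_def a_def g0 w)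
  next
    case (Suc n)
    have "g n < \<infinity>" using Suc.prems incseqD[OF mono, of n "Suc n"] by (auto intro: le_less_trans)
    note IH = Suc.IH[OF this]
    have "s (Suc n) = l n * (1 / \<theta>)" by (simp add: s_def l_def a_def)
    also have "1 / \<theta> = 1 - 1 / \<theta>'" using \<theta> by simp
    finally have "s (Suc n) = l n - l n / \<theta>'" by (simp add: right_diff_distrib)
    moreover have "l n = s n + \<mu> * (a (Suc n) - a n) + \<sigma> * (w (a (Suc n)) - w (a n))"
      by (simp add: l_def free_flow_def)
    then have "l n = x0 + \<mu> * a (Suc n) + \<sigma> * w (a (Suc n)) - (\<Sum>i<n. l i / \<theta>')"
      unfolding IH by (simp add: right_diff_distrib)
    ultimately show ?case unfolding sum.lessThan_Suc by linarith
  qed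
  have "solves_jump_sde \<mu> \<sigma> \<theta>' x0 w g x"
    unfolding solves_jump_sde_def
  proof (intro exI[of _ l] conjI allI impI)
    fix n assume f: "g (Suc n) < \<infinity>"
    have fn: "g n < \<infinity>" using f incseqD[OF mono, of n "Suc n"] by (auto intro: le_less_trans)
    \<comment> \<open>Strictness makes the interval before \<open>a (Suc n)\<close> nonempty, so the
      free flow started at \<open>a n\<close> governs the left limit there.\<close>
    have lt: "a n < a (Suc n)" using strict[OF fn] a[OF fn] a[OF f] by simp
    \<comment> \<open>The interval reaches past \<open>a (Suc n)\<close> to make that time an
      interior point, where continuity on an open set gives \<open>isCont\<close>.\<close>
    have "continuous_on {a n<..<a (Suc n) + 1} (\<lambda>t. free_flow \<mu> \<sigma> w (a n) (s n) (t - a n))"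
      unfolding free_flow_def
      by (intro continuous_intros continuous_on_compose2[OF w(1)]) (use a0[of n] in auto)
    then have "isCont (\<lambda>t. free_flow \<mu> \<sigma> w (a n) (s n) (t - a n)) (a (Suc n))"
      using lt by (auto simp: continuous_on_eq_continuous_at)
    then have "((\<lambda>t. free_flow \<mu> \<sigma> w (a n) (s n) (t - a n)) \<longlongrightarrow> l n) (at_left (a (Suc n)))"
      unfolding isCont_def l_def by (rule filterlim_mono[OF _ order_refl]) (rule at_le; simp)
    moreover have "\<forall>\<^sub>F t in at_left (a (Suc n)). free_flow \<mu> \<sigma> w (a n) (s n) (t - a n) = x t"
    proof (rule eventually_mono[OF eventually_at_left_real[OF lt]])
      fix t assume "t \<in> {a n<..<a (Suc n)}"
      then have "g n \<le> ereal t" "ereal t < g (Suc n)" using a[OF fn] a[OF f] by auto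
      from x_eq[OF this] show "free_flow \<mu> \<sigma> w (a n) (s n) (t - a n) = x t" by (simp add: x_def)
    qed
    ultimately show "(x \<longlongrightarrow> l n) (at_left (real_of_ereal (g (Suc n))))"
      unfolding a_def[of "Suc n", symmetric] by (rule Lim_transform_eventually)
  next
    fix t :: real assume "0 \<le> t"
    then obtain n where n: "g n \<le> ereal t" "ereal t < g (Suc n)" using ex by blast
    \<comment> \<open>Index \<open>k\<close> stands for interaction \<open>Suc k\<close>, so exactly
      the first \<open>n\<close> interactions have occurred by time \<open>t\<close>.\<close>
    have set: "{k. g (Suc k) \<le> ereal t} = {..<n}"
    proof (intro set_eqI iffI)
      fix k assume "k \<in> {k. g (Suc k) \<le> ereal t}"
      then have "g (Suc k) < g (Suc n)" using n by auto
      then have "\<not> Suc n \<le> Suc k" using mono by (meson incseqD leD)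
      then show "k \<in> {..<n}" by simp
    next
      fix k assume "k \<in> {..<n}"
      then have "g (Suc k) \<le> g n" using mono by (auto intro: incseqD)
      with n show "k \<in> {k. g (Suc k) \<le> ereal t}" by auto
    qed
    show "finite {k. g (Suc k) \<le> ereal t}" unfolding set by simp
    have "x t = free_flow \<mu> \<sigma> w (a n) (s n) (t - a n)" using x_eq[OF n] by (simp add: x_def)
    also have "\<dots> = x0 + \<mu> * t + \<sigma> * w t - (\<Sum>i<n. l i / \<theta>')"
      using state[OF fin[OF n(1)]] by (simp add: free_flow_def algebra_simps)
    finally show "x t = x0 + \<mu> * t + \<sigma> * w t - (\<Sum>k | g (Suc k) \<le> ereal t. l k / \<theta>')"
      unfolding set .
  qed
  with xt show ?thesis by blast
qed

theorem theorem3p4: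
  fixes M :: "'a measure" and W :: "real \<Rightarrow> 'a \<Rightarrow> real" and \<gamma> :: "nat \<Rightarrow> 'a \<Rightarrow> ereal"
    and lam \<sigma> \<mu> \<theta> \<theta>' x0 \<alpha> :: real
  assumes "lam > 0" and "\<sigma> > 0" and "\<theta> > 1" and "1 / \<theta> + 1 / \<theta>' = 1"
    and "0 \<le> \<alpha>" and "\<alpha> < 1"
    and "standard_brownian_motion M W"
    and "interaction_times M W lam \<alpha> \<mu> \<sigma> \<theta> x0 \<gamma>"
  shows "AE \<omega> in M.
      (\<forall>n. \<gamma> n \<omega> < \<infinity> \<longrightarrow> \<gamma> n \<omega> < \<gamma> (Suc n) \<omega>) \<and>
      (\<lambda>n. \<gamma> n \<omega>) \<longlonglongrightarrow> \<infinity> \<and>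
      (\<exists>x. (\<forall>t\<ge>0. jump_process \<mu> \<sigma> \<theta> x0 (\<lambda>s. W s \<omega>) (\<lambda>n. \<gamma> n \<omega>) t = Some (x t)) \<and>
           solves_jump_sde \<mu> \<sigma> \<theta>' x0 (\<lambda>s. W s \<omega>) (\<lambda>n. \<gamma> n \<omega>) x)"
proof -
  interpret jump_model M W \<gamma> lam \<alpha> \<mu> \<sigma> \<theta> x0
    using assms by unfold_locales
  from AE_no_accumulation AE_space show ?thesis
  proof eventually_elim
    case (elim \<omega>)
    have "\<exists>x. (\<forall>t\<ge>0. jump_process \<mu> \<sigma> \<theta> x0 (\<lambda>s. W s \<omega>) (\<lambda>n. \<gamma> n \<omega>) t = Some (x t)) \<and>
           solves_jump_sde \<mu> \<sigma> \<theta>' x0 (\<lambda>s. W s \<omega>) (\<lambda>n. \<gamma> n \<omega>) x"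
    proof (rule jump_process_solves_jump_sde)
      show "W 0 \<omega> = 0" using bm elim(2) by (simp add: standard_brownian_motion_def)
      show "incseq (\<lambda>n. \<gamma> n \<omega>)" by (rule incseq_SucI) (rule \<gamma>_Suc[OF elim(2)])
    qed (use elim assms W_continuous \<gamma>_0 in auto)
    with elim(1) show ?case by simp
  qed
qed

end
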